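(* Let $\mathsf{k}$ be a field of characteristic $p>2$, let $G=\langle g\rangle\cong\mathbb{Z}/n\mathbb{Z}$ be the cyclic group of order $n$ with $n$ divisible by $p$, and let $V$ be the two-dimensional right $\mathsf{k}G$-module with basis $\{v_1,v_2\}$ and action $v_1\cdot g=v_1$, $v_2\cdot g=v_1+v_2$, regarded as a Yetter--Drinfeld module over $\mathsf{k}G$ concentrated in degree $g$ (that is, $V_g=V$). Write $a=v_1$ and $b=v_2$. Then the Nichols algebra $\mathcal{B}(V)$ is the quotient of the tensor algebra $T(V)=\mathsf{k}\langle a,b\rangle$ by the two-sided ideal generated by $$a^p,\qquad b^p,\qquad ba-ab-\tfrac12 a^2.$$ It has dimension $p^2$ and basis (the images of) $\{a^ib^j\mid 0\le i,j\le p-1\}$.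
   Context: Definition of the Nichols algebra used here. Let $Q$ be the quiver with vertex set $G$ and, for each $0\le j\le n-1$, exactly two arrows from $g^j$ to $g^{j+1}$, denoted $a^{i}_{g^j}$ ($i=1,2$), where $a^i_{g^j}$ corresponds to $g^j\otimes v_i$ in $B=\mathsf{k}G\otimes V$. For an arrow $\alpha$, $s(\alpha)$ and $t(\alpha)$ denote its source and target. For $v=\lambda_1v_1+\lambda_2v_2\in V$ identify $h\otimes v$ with $\lambda_1a^1_h+\lambda_2a^2_h$. The group $G$ acts on the span $B$ of the arrows on the left by $l\cdot(h\otimes v)=lh\otimes v$ and on the right by $(h\otimes v)\cdot l=hl\otimes (v\cdot l)$. Let $\mathsf{k}Q$ be the path coalgebra: the vector space with basis all paths $a_m\cdots a_2a_1$ (arrows with $s(a_{j+1})=t(a_j)$; vertices are paths of length $0$), with $\Delta(h)=h\otimes h$ for $h\in G$ and $\Delta(a_m\cdots a_1)=\sum_{i=0}^m a_m\cdots a_{i+1}\otimes a_i\cdots a_1$, where the empty products for $i=m$ and $i=0$ are read as $t(a_m)$ and $s(a_1)$ respectively. $\mathsf{k}Q$ is a pointed graded Hopf algebra with the following product. For a path $\alpha$ of length $m$ and a subset $d\subseteq\{1,\dots,q\}$ of cardinality $m$, let $d\alpha=((d\alpha)_q,\dots,(d\alpha)_1)$ be the unique sequence of vertices and arrows whose concatenation is $\alpha$ and whose arrows occupy exactly the positions in $d$. For paths $\alpha,\beta$ of lengths $m,m'$, $$\alpha\cdot\beta=\sum_{d}\big[(d\alpha)_{m+m'}\cdot(\overline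 d\beta)_{m+m'}\big]\cdots\big[(d\alpha)_1\cdot(\overline d\beta)_1\big],$$ the sum being over all $m$-element subsets $d$ of $\{1,\dots,m+m'\}$, where $\overline d$ is the complement of $d$, each factor $(d\alpha)_i\cdot(\overline d\beta)_i$ is given by the left or right action of $G$ on $B$ (exactly one of the two entries is an arrow, the other a vertex), and the square brackets are concatenated as paths (extended multilinearly). For two vertices the product is the product in $G$. The Nichols algebra $\mathcal{B}(V)$ is the subalgebra of $\mathsf{k}Q$ generated by $V$, identified with the span of the arrows $1\otimes v_1$ and $1\otimes v_2$ from $1$ to $g$. (This agrees with the usual Nichols algebra of the Yetter--Drinfeld module $V$.) The isomorphism in the claim is the one induced by the algebra map $T(V)\to\mathcal{B}(V)$ extending the inclusion of $V$, so $a\mapsto 1\otimes v_1$, $b\mapsto 1\otimes v_2$. *)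

theory Defs
  imports
    "HOL-Library.Poly_Mapping"
    "HOL-Algebra.QuotRing"
    "HOL-Algebra.Generated_Groups"
    "HOL-Algebra.Algebraic_Closure_Type"
begin

section \<open>Vector spaces of finitely supported functions\<close>

text \<open>
  The vector space with basis \<^typ>\<open>'x\<close> over a field \<^typ>\<open>'k\<close> is \<open>'x \<Rightarrow>\<^sub>0 'k\<close>; the basis vector
  \<open>x\<close> is \<open>Poly_Mapping.single x 1\<close>.
\<close>

definition scal :: "'k::field \<Rightarrow> ('x \<Rightarrow>\<^sub>0 'k) \<Rightarrow> ('x \<Rightarrow>\<^sub>0 'k)"
  where "scal c = Poly_Mapping.map ((*) c)"

lemma lookup_scal [simp]: "Poly_Mapping.lookup (scal c x) k = c * Poly_Mapping.lookup x k"
  unfolding scal_def by (simp add: Poly_Mapping.map.rep_eq when_def)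

global_interpretation vec: vector_space scal
  by unfold_locales (auto intro!: poly_mapping_eqI simp: lookup_add algebra_simps)

definition bilin :: "('x \<Rightarrow> 'y \<Rightarrow> ('z \<Rightarrow>\<^sub>0 'k)) \<Rightarrow> ('x \<Rightarrow>\<^sub>0 'k) \<Rightarrow> ('y \<Rightarrow>\<^sub>0 'k) \<Rightarrow> ('z \<Rightarrow>\<^sub>0 'k::field)"
  where "bilin f x y = (\<Sum>s\<in>Poly_Mapping.keys x. \<Sum>t\<in>Poly_Mapping.keys y.
           scal (Poly_Mapping.lookup x s * Poly_Mapping.lookup y t) (f s t))"


section \<open>The module \<open>V\<close>\<close>

datatype idx = V1 | V2

abbreviation bas :: "idx \<Rightarrow> (idx \<Rightarrow>\<^sub>0 'k::field)"
  where "bas i \<equiv> Poly_Mapping.single i 1"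

text \<open>\<open>V = (idx \<Rightarrow>\<^sub>0 'k)\<close> has basis \<open>bas V1, bas V2\<close>; \<open>act v l\<close> is \<open>v \<cdot> l\<close>.\<close>

definition right_group_module ::
    "('g, 'm) monoid_scheme \<Rightarrow> ((idx \<Rightarrow>\<^sub>0 'k::field) \<Rightarrow> 'g \<Rightarrow> (idx \<Rightarrow>\<^sub>0 'k)) \<Rightarrow> bool"
  where "right_group_module G act \<longleftrightarrow>
    (\<forall>l\<in>carrier G. Vector_Spaces.linear scal scal (\<lambda>v. act v l)) \<and>
    (\<forall>v. act v \<one>\<^bsub>G\<^esub> = v) \<and>
    (\<forall>v. \<forall>l\<in>carrier G. \<forall>h\<in>carrier G. act v (l \<otimes>\<^bsub>G\<^esub> h) = act (act v l) h)"


section \<open>The tensor algebra\<close>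

text \<open>
  With words as a monoid under concatenation, the convolution product of
  \<^theory>\<open>HOL-Library.Poly_Mapping\<close> makes \<open>'x word \<Rightarrow>\<^sub>0 'k\<close> the free associative algebra on
  \<^typ>\<open>'x\<close>. For \<open>'x = idx\<close> this is \<open>T(V)\<close>.
\<close>

datatype 'x word = Word (letters: "'x list")

instantiation word :: (type) monoid_add
begin

definition zero_word :: "'a word"
  where "0 = Word []"

definition plus_word :: "'a word \<Rightarrow> 'a word \<Rightarrow> 'a word"
  where "u + w = Word (letters u @ letters w)"

instance
  by standard (simp_all add: zero_word_def plus_word_def)

end

definition gen :: "'x \<Rightarrow> ('x word \<Rightarrow>\<^sub>0 'k::field)"
  where "gen i = Poly_Mapping.single (Word [i]) 1"

abbreviation tensor_ring :: "(idx word \<Rightarrow>\<^sub>0 'k::field) ring"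
  where "tensor_ring \<equiv> ring_of_type_algebra"


section \<open>Paths\<close>

text \<open>
  For each \<open>h \<in> G\<close> and \<open>i\<close> the quiver has one arrow \<open>h \<longrightarrow> h g\<close>, corresponding to \<open>h \<otimes> v\<^sub>i\<close>.
  Hence a path is determined by its source and the list of indices of its arrows, and is encoded so.
  The list starts with the arrow traversed first, so the path \<open>a\<^sub>m \<dots> a\<^sub>2 a\<^sub>1\<close> has the
  indices of \<open>a\<^sub>1, a\<^sub>2, \<dots>, a\<^sub>m\<close> in this order. Vertices are \<open>Path h []\<close>, arrows \<open>Path h [i]\<close>.
\<close>

datatype 'g path = Path (src: 'g) (arrows: "idx list")

definition len :: "'g path \<Rightarrow> nat"
  where "len \<alpha> = length (arrows \<alpha>)"

definition tgt :: "('g, 'm) monoid_scheme \<Rightarrow> 'g \<Rightarrow> 'g path \<Rightarrow> 'g"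
  where "tgt G g \<alpha> = src \<alpha> \<otimes>\<^bsub>G\<^esub> (g [^]\<^bsub>G\<^esub> len \<alpha>)"

text \<open>The identification of \<open>h \<otimes> v\<close> with a linear combination of arrows.\<close>

definition tens :: "'g \<Rightarrow> (idx \<Rightarrow>\<^sub>0 'k::field) \<Rightarrow> ('g path \<Rightarrow>\<^sub>0 'k)"
  where "tens h v = Poly_Mapping.single (Path h [V1]) (Poly_Mapping.lookup v V1)
                  + Poly_Mapping.single (Path h [V2]) (Poly_Mapping.lookup v V2)"

text \<open>
  Concatenation, with the path traversed first as first argument (the reverse of the order
  in which the concatenation is written).
\<close>

definition path_concat ::
    "('g, 'm) monoid_scheme \<Rightarrow> 'g \<Rightarrow> 'g path \<Rightarrow> 'g path \<Rightarrow> ('g path \<Rightarrow>\<^sub>0 'k::field)"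
  where "path_concat G g \<alpha> \<beta> =
    (if src \<beta> = tgt G g \<alpha> then Poly_Mapping.single (Path (src \<alpha>) (arrows \<alpha> @ arrows \<beta>)) 1 else 0)"

fun concat_seq ::
    "('g, 'm) monoid_scheme \<Rightarrow> 'g \<Rightarrow> ('g path \<Rightarrow>\<^sub>0 'k) list \<Rightarrow> ('g path \<Rightarrow>\<^sub>0 'k::field)"
  where
    "concat_seq G g [] = 0"
  | "concat_seq G g [x] = x"
  | "concat_seq G g (x # y # xs) = bilin (path_concat G g) x (concat_seq G g (y # xs))"


section \<open>The product of the path Hopf algebra\<close>

text \<open>
  \<open>thin G g d \<alpha> i\<close> is the entry \<open>(d\<alpha>)\<^sub>i\<close>: before position \<open>i\<close> exactly
  \<open>card (d \<inter> {1..<i})\<close> arrows of \<open>\<alpha>\<close> have been used.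
\<close>

definition thin :: "('g, 'm) monoid_scheme \<Rightarrow> 'g \<Rightarrow> nat set \<Rightarrow> 'g path \<Rightarrow> nat \<Rightarrow> 'g path"
  where "thin G g d \<alpha> i =
    (let r = card (d \<inter> {1..<i}); h = src \<alpha> \<otimes>\<^bsub>G\<^esub> (g [^]\<^bsub>G\<^esub> r)
     in if i \<in> d then Path h [arrows \<alpha> ! r] else Path h [])"

text \<open>The product of two entries, exactly one of which is an arrow; other cases do not occur.\<close>

fun entry_mult ::
    "('g, 'm) monoid_scheme \<Rightarrow> ((idx \<Rightarrow>\<^sub>0 'k) \<Rightarrow> 'g \<Rightarrow> (idx \<Rightarrow>\<^sub>0 'k)) \<Rightarrow>
     'g path \<Rightarrow> 'g path \<Rightarrow> ('g path \<Rightarrow>\<^sub>0 'k::field)"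
  where
    "entry_mult G act (Path l []) (Path h [i]) = tens (l \<otimes>\<^bsub>G\<^esub> h) (bas i)"
  | "entry_mult G act (Path h [i]) (Path l []) = tens (h \<otimes>\<^bsub>G\<^esub> l) (act (bas i) l)"
  | "entry_mult G act _ _ = 0"

definition path_mult ::
    "('g, 'm) monoid_scheme \<Rightarrow> 'g \<Rightarrow> ((idx \<Rightarrow>\<^sub>0 'k) \<Rightarrow> 'g \<Rightarrow> (idx \<Rightarrow>\<^sub>0 'k)) \<Rightarrow>
     'g path \<Rightarrow> 'g path \<Rightarrow> ('g path \<Rightarrow>\<^sub>0 'k::field)"
  where "path_mult G g act \<alpha> \<beta> =
    (let q = len \<alpha> + len \<beta> in
     if q = 0 then Poly_Mapping.single (Path (src \<alpha> \<otimes>\<^bsub>G\<^esub> src \<beta>) []) 1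
     else \<Sum>d\<in>{d. d \<subseteq> {1..q} \<and> card d = len \<alpha>}.
            concat_seq G g
              (map (\<lambda>i. entry_mult G act (thin G g d \<alpha> i) (thin G g ({1..q} - d) \<beta> i)) [1..<Suc q]))"

definition path_algebra ::
    "('g, 'm) monoid_scheme \<Rightarrow> 'g \<Rightarrow> ((idx \<Rightarrow>\<^sub>0 'k) \<Rightarrow> 'g \<Rightarrow> (idx \<Rightarrow>\<^sub>0 'k)) \<Rightarrow> ('g path \<Rightarrow>\<^sub>0 'k::field) ring"
  where "path_algebra G g act =
    \<lparr>carrier = {x. \<forall>\<alpha>\<in>Poly_Mapping.keys x. src \<alpha> \<in> carrier G},
     monoid.mult = bilin (path_mult G g act),
     one = Poly_Mapping.single (Path \<one>\<^bsub>G\<^esub> []) 1,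
     zero = 0,
     add = (+)\<rparr>"


section \<open>The Nichols algebra\<close>

inductive_set nichols_carrier ::
    "('g, 'm) monoid_scheme \<Rightarrow> 'g \<Rightarrow> ((idx \<Rightarrow>\<^sub>0 'k) \<Rightarrow> 'g \<Rightarrow> (idx \<Rightarrow>\<^sub>0 'k)) \<Rightarrow> ('g path \<Rightarrow>\<^sub>0 'k::field) set"
  for G :: "('g, 'm) monoid_scheme" and g act
  where
    one: "\<one>\<^bsub>path_algebra G g act\<^esub> \<in> nichols_carrier G g act"
  | gens: "tens \<one>\<^bsub>G\<^esub> v \<in> nichols_carrier G g act"
  | add: "x \<in> nichols_carrier G g act \<Longrightarrow> y \<in> nichols_carrier G g act \<Longrightarrow>
      x \<oplus>\<^bsub>path_algebra G g act\<^esub> y \<in> nichols_carrier G g act"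
  | scal: "x \<in> nichols_carrier G g act \<Longrightarrow> scal c x \<in> nichols_carrier G g act"
  | mult: "x \<in> nichols_carrier G g act \<Longrightarrow> y \<in> nichols_carrier G g act \<Longrightarrow>
      x \<otimes>\<^bsub>path_algebra G g act\<^esub> y \<in> nichols_carrier G g act"

definition nichols_algebra ::
    "('g, 'm) monoid_scheme \<Rightarrow> 'g \<Rightarrow> ((idx \<Rightarrow>\<^sub>0 'k) \<Rightarrow> 'g \<Rightarrow> (idx \<Rightarrow>\<^sub>0 'k)) \<Rightarrow> ('g path \<Rightarrow>\<^sub>0 'k::field) ring"
  where "nichols_algebra G g act = (path_algebra G g act)\<lparr>carrier := nichols_carrier G g act\<rparr>"

end

(*
  A path that starts at 1 is a word in V1, V2, so the Nichols algebra lives in a twisted shuffle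
  algebra on words: when the last letter of a product comes from the left factor, it is acted on by
  g^m, where m is the length of the right factor.  Stripping the last letter gives two skew
  derivations d1, d2 (skew V1, skew V2) with d2 (x y) = x d2 y + d2 x y and d1 (x y) = x d1 y + d1 x y + m d2 x y for
  y of length m, and an element without constant term that is killed by both vanishes.  Hence
  d1 a^i = i a^(i-1), d2 b^j = j b^(j-1) and d1 b^j = (j choose 2) b^(j-1), from which the three
  relations follow in characteristic p > 2.  Modulo the relations the words a^i b^j with i, j < p
  span, and d1^i d2^j shows that their images are independent; so the relations generate the kernel.
*)
theory Submission
  imports Defs
begin

section \<open>Linear and bilinear extension\<close>

text \<open>The path product is a sum over subsets, and nothing is known in advance about its
  associativity, yet the quotient argument needs a ring. The ring axioms are obtained only where
  they matter: on paths from the unit the product becomes a recursive product on words, its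
  associativity is tested with the two skew derivations, and the Nichols algebra inherits the axioms
  as an image of the tensor algebra. The coefficient 1/2 is forced. In the shuffle algebra d2 kills
  b a - a b and d1 sends it to a, because b is twisted once when it comes after a, while d1 (a^2) =
  2 a. The coefficient (j choose 2) of d1 b^j adds up the same twists, 0 + 1 + ... + (j - 1); at j =
  p it vanishes because 2 is invertible. For independence the order of the derivations matters: d1
  also acts on powers of b, so d2 has to remove b first.\<close>

abbreviation lin :: "(('x \<Rightarrow>\<^sub>0 'k::field) \<Rightarrow> ('y \<Rightarrow>\<^sub>0 'k)) \<Rightarrow> bool"
  where "lin \<equiv> Vector_Spaces.linear scal scal"

lemma lin_iff:
  "lin f \<longleftrightarrow> (\<forall>x y. f (x + y) = f x + f y) \<and> (\<forall>c x. f (scal c x) = scal c (f x))"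
  unfolding linear_iff_module_hom module_hom_def module_hom_axioms_def
  by (auto intro: vec.module_axioms)

lemma lin_add: "lin f \<Longrightarrow> f (x + y) = f x + f y"
  and lin_scal: "lin f \<Longrightarrow> f (scal c x) = scal c (f x)"
  by (simp_all add: lin_iff)

lemma lin_zero: "lin f \<Longrightarrow> f 0 = 0"
  using lin_scal[of f 0 0] by simp

lemma lin_sum: "lin f \<Longrightarrow> f (sum h A) = (\<Sum>i\<in>A. f (h i))"
  by (induction A rule: infinite_finite_induct) (simp_all add: lin_zero lin_add)

lemma lin_minus: "lin f \<Longrightarrow> f (- x) = - f x"
  using lin_scal[of f "- 1" x] by simp

lemma lin_diff: "lin f \<Longrightarrow> f (x - y) = f x - f y"
  using lin_add[of f x "- y"] by (simp add: lin_minus)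

lemma scal_single [simp]: "scal c (Poly_Mapping.single s d) = Poly_Mapping.single s (c * d)"
  by (rule poly_mapping_eqI) (simp add: lookup_single when_def)

lemma sum_scal_keys:
  "x = (\<Sum>s\<in>Poly_Mapping.keys x. scal (Poly_Mapping.lookup x s) (Poly_Mapping.single s 1))"
proof (rule poly_mapping_eqI)
  fix t
  show "Poly_Mapping.lookup x t = Poly_Mapping.lookup
      (\<Sum>s\<in>Poly_Mapping.keys x. scal (Poly_Mapping.lookup x s) (Poly_Mapping.single s 1)) t"
    by (simp add: lookup_sum lookup_single when_def in_keys_iff)
qed

lemma lin_eqI:
  assumes "lin f" "lin g" "\<And>s. f (Poly_Mapping.single s 1) = g (Poly_Mapping.single s 1)"
  shows "f x = g x"
  by (subst (1 2) sum_scal_keys[of x]) (simp only: lin_sum lin_scal assms)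

definition lext :: "('x \<Rightarrow> ('y \<Rightarrow>\<^sub>0 'k)) \<Rightarrow> ('x \<Rightarrow>\<^sub>0 'k) \<Rightarrow> ('y \<Rightarrow>\<^sub>0 'k::field)"
  where "lext f x = (\<Sum>s\<in>Poly_Mapping.keys x. scal (Poly_Mapping.lookup x s) (f s))"

text \<open>The support depends on the vector, so additivity is compared over a common finite
  superset.\<close>

lemma lext_superset:
  assumes "finite A" "Poly_Mapping.keys x \<subseteq> A"
  shows "lext f x = (\<Sum>s\<in>A. scal (Poly_Mapping.lookup x s) (f s))"
  unfolding lext_def using assms by (intro sum.mono_neutral_left) (auto simp: in_keys_iff)

lemma lin_lext: "lin (lext f)"
proof -
  have "lext f (x + y) = lext f x + lext f y" for x y
  proof -
    let ?A = "Poly_Mapping.keys x \<union> Poly_Mapping.keys y"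
    have "Poly_Mapping.keys (x + y) \<subseteq> ?A" by (rule Poly_Mapping.keys_add)
    then show ?thesis
      by (simp add: lext_superset[of ?A] lookup_add vec.scale_left_distrib sum.distrib)
  qed
  moreover have "lext f (scal c x) = scal c (lext f x)" for c x
  proof -
    have "Poly_Mapping.keys (scal c x) \<subseteq> Poly_Mapping.keys x" by (auto simp: in_keys_iff)
    then show ?thesis
      by (simp add: lext_superset[of "Poly_Mapping.keys x"] vec.scale_sum_right)
  qed
  ultimately show ?thesis by (simp add: lin_iff)
qed

lemma lext_single [simp]: "lext f (Poly_Mapping.single s c) = scal c (f s)"
  by (simp add: lext_def)

lemma bilin_lext: "bilin f x y = lext (\<lambda>s. lext (f s) y) x"
  by (simp add: bilin_def lext_def vec.scale_sum_right)

lemma bilin_single [simp]: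
  "bilin f (Poly_Mapping.single s c) (Poly_Mapping.single t d) = scal (c * d) (f s t)"
  by (simp add: bilin_lext)

text \<open>Identities between multilinear maps are checked on basis words, one argument at a time;
  these rules discharge the linearity obligations.\<close>

named_theorems lin_intros

lemma lin_comp: "lin f \<Longrightarrow> lin g \<Longrightarrow> lin (\<lambda>x. f (g x))"
  by (simp add: lin_iff)

lemma lin_ident [lin_intros]: "lin (\<lambda>x. x)"
  and lin_const_0 [lin_intros]: "lin (\<lambda>x. 0)"
  by (simp_all add: lin_iff)

lemma lin_plus [lin_intros]: "lin f \<Longrightarrow> lin g \<Longrightarrow> lin (\<lambda>x. f x + g x)"
  by (simp add: lin_iff vec.scale_right_distrib)

lemma lin_scale [lin_intros]: "lin f \<Longrightarrow> lin (\<lambda>x. scal c (f x))"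
  by (simp add: lin_iff vec.scale_right_distrib mult.commute)

lemma lin_If [lin_intros]: "lin f \<Longrightarrow> lin g \<Longrightarrow> lin (\<lambda>x. if P then f x else g x)"
  by (cases P) simp_all

lemma lin_bilin_left [lin_intros]: "lin f \<Longrightarrow> lin (\<lambda>x. bilin h (f x) y)"
  unfolding bilin_lext by (rule lin_comp[OF lin_lext])

lemma lin_bilin_right [lin_intros]: "lin f \<Longrightarrow> lin (\<lambda>y. bilin h x (f y))"
proof (rule lin_comp[of "bilin h x"])
  show "lin (bilin h x)"
    by (simp add: lin_iff bilin_lext lin_add[OF lin_lext] lin_scal[OF lin_lext])
      (simp add: lext_def sum.distrib vec.scale_right_distrib vec.scale_sum_right mult_ac)
qed

text \<open>The scalars sit in the algebra as multiples of the basis vector at the neutral element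
  \<open>0\<close> of the monoid.\<close>

lemma scal_conv_times: "scal c x = Poly_Mapping.single 0 c * (x :: 'x::monoid_add \<Rightarrow>\<^sub>0 'k::field)"
  by (simp add: scal_def mult_map_scale_conv_mult)

lemma scal_mult_left [simp]:
  "scal c x * y = scal c (x * (y :: 'x::monoid_add \<Rightarrow>\<^sub>0 'k::field))"
  by (simp add: scal_conv_times mult.assoc)

lemma scal_mult_right [simp]:
  "x * scal c y = scal c (x * (y :: 'x::monoid_add \<Rightarrow>\<^sub>0 'k::field))"
proof -
  let ?c = "Poly_Mapping.single 0 c"
  have "x * ?c = ?c * x"
  proof (rule lin_eqI[of "\<lambda>x. x * ?c" "\<lambda>x. ?c * x"])
    show "lin (\<lambda>x. x * ?c)" by (simp add: lin_iff distrib_right)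
    show "lin (\<lambda>x. ?c * x)"
      by (simp add: lin_iff vec.scale_right_distrib mult.commute flip: scal_conv_times)
  qed (simp add: mult_single)
  then show ?thesis by (simp add: scal_conv_times mult.assoc[symmetric])
qed

lemma lin_times_left [lin_intros]:
  "lin f \<Longrightarrow> lin (\<lambda>x. f x * (y :: 'x::monoid_add \<Rightarrow>\<^sub>0 'k::field))"
  and lin_times_right [lin_intros]:
  "lin f \<Longrightarrow> lin (\<lambda>x. (y :: 'x::monoid_add \<Rightarrow>\<^sub>0 'k::field) * f x)"
  by (simp_all add: lin_iff distrib_left distrib_right)

text \<open>\<open>vec.independent\<close> speaks of sets, which forget repetitions; the dimension
  count also needs the family to be injective, and both follow from the vanishing of
  coefficients.\<close>

lemma independent_family:
  fixes f :: "'i \<Rightarrow> ('x \<Rightarrow>\<^sub>0 'k::field)"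
  assumes "finite A"
    and zero: "\<And>c. (\<Sum>i\<in>A. scal (c i) (f i)) = 0 \<Longrightarrow> \<forall>i\<in>A. c i = 0"
  shows "inj_on f A" and "vec.independent (f ` A)"
proof -
  show inj: "inj_on f A"
  proof (rule inj_onI, rule ccontr)
    fix i j assume ij: "i \<in> A" "j \<in> A" "f i = f j" "i \<noteq> j"
    \<comment> \<open>Two equal members give the nontrivial relation
      \<open>f i - f j = 0\<close>.\<close>
    define c :: "'i \<Rightarrow> 'k" where "c = (\<lambda>l. if l = i then 1 else if l = j then - 1 else 0)"
    have "(\<Sum>l\<in>A. scal (c l) (f l)) = (\<Sum>l\<in>{i, j}. scal (c l) (f l))"
      using ij \<open>finite A\<close> by (intro sum.mono_neutral_right) (auto simp: c_def)
    also have "\<dots> = 0" using ij by (simp add: c_def)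
    finally have "c i = 0" using zero ij by blast
    then show False by (simp add: c_def)
  qed
  show "vec.independent (f ` A)"
  proof (rule vec.independent_if_scalars_zero)
    fix c x assume *: "(\<Sum>x\<in>f ` A. scal (c x) x) = 0" and x: "x \<in> f ` A"
    have "(\<Sum>i\<in>A. scal (c (f i)) (f i)) = 0"
      using * by (simp add: sum.reindex[OF inj])
    then show "c x = 0" using zero[of "\<lambda>i. c (f i)"] x by blast
  qed (simp add: \<open>finite A\<close>)
qed


section \<open>The quantum shuffle product\<close>

definition mon :: "'x list \<Rightarrow> ('x word \<Rightarrow>\<^sub>0 'k::field)"
  where "mon u = Poly_Mapping.single (Word u) 1"

lemma mon_Nil: "mon [] = 1"
  by (simp add: mon_def zero_word_def[symmetric])

lemma mon_append: "mon (u @ v) = mon u * mon v"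
  by (simp add: mon_def mult_single plus_word_def)

lemma gen_mon: "gen i = mon [i]"
  by (simp add: gen_def mon_def)

lemma mon_snoc: "mon (u @ [i]) = mon u * gen i"
  and mon_Cons: "mon (i # u) = gen i * mon u"
  by (simp_all add: gen_mon flip: mon_append)

lemma lin_eq_monI:
  assumes "lin f" "lin g" "\<And>u. f (mon u) = g (mon u)"
  shows "f x = g x"
proof (rule lin_eqI[OF assms(1,2)])
  show "f (Poly_Mapping.single s 1) = g (Poly_Mapping.single s 1)" for s
    using assms(3)[of "letters s"] by (simp add: mon_def)
qed

text \<open>\<open>shr\<close> reads its words from the last letter, so words are presented as
  reversals.\<close>

lemma lin_eq_mon_revI:
  assumes "lin f" "lin g" "\<And>u. f (mon (rev u)) = g (mon (rev u))"
  shows "f x = g x"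
proof (rule lin_eq_monI[OF assms(1,2)])
  show "f (mon u) = g (mon u)" for u
    using assms(3)[of "rev u"] by simp
qed

text \<open>\<open>tw i k\<close> is \<open>v\<^sub>i \<cdot> g\<^sup>k\<close>.\<close>

fun tw :: "idx \<Rightarrow> nat \<Rightarrow> (idx word \<Rightarrow>\<^sub>0 'k::field)"
  where
    "tw V1 k = gen V1"
  | "tw V2 k = gen V2 + scal (of_nat k) (gen V1)"

text \<open>
  The words are given in reverse, so the recursion splits off the last letter: then the action of
  \<open>G\<close> only ever hits a single letter.
\<close>

fun shr :: "idx list \<Rightarrow> idx list \<Rightarrow> (idx word \<Rightarrow>\<^sub>0 'k::field)"
  where
    "shr [] v = mon (rev v)"
  | "shr (i # u) [] = mon (rev (i # u))"
  | "shr (i # u) (j # v) = shr u (j # v) * tw i (Suc (length v)) + shr (i # u) v * gen j"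

lemma shr_Nil_right [simp]: "shr u [] = mon (rev u)"
  by (cases u) simp_all

definition qmul :: "(idx word \<Rightarrow>\<^sub>0 'k::field) \<Rightarrow> (idx word \<Rightarrow>\<^sub>0 'k) \<Rightarrow> (idx word \<Rightarrow>\<^sub>0 'k)"
    (infixl "\<star>" 70)
  where "x \<star> y = bilin (\<lambda>u v. shr (rev (letters u)) (rev (letters v))) x y"

lemma lin_qmul_left [lin_intros]: "lin f \<Longrightarrow> lin (\<lambda>x. f x \<star> y)"
  and lin_qmul_right [lin_intros]: "lin f \<Longrightarrow> lin (\<lambda>y. x \<star> f y)"
  unfolding qmul_def by (intro lin_intros; assumption)+

lemma qmul_mon: "mon (rev u) \<star> mon (rev v) = shr u v"
  by (simp add: qmul_def mon_def)

lemmas qmul_lin_simps = lin_add[OF lin_qmul_left[OF lin_ident]] lin_add[OF lin_qmul_right[OF lin_ident]]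
  lin_scal[OF lin_qmul_left[OF lin_ident]] lin_scal[OF lin_qmul_right[OF lin_ident]]
  lin_zero[OF lin_qmul_left[OF lin_ident]] lin_zero[OF lin_qmul_right[OF lin_ident]]

lemma qmul_one_left [simp]: "1 \<star> x = x"
proof (rule lin_eq_mon_revI[of "\<lambda>x. 1 \<star> x" "\<lambda>x. x"])
  show "1 \<star> mon (rev u) = mon (rev u)" for u
    using qmul_mon[of "[]" u] by (simp add: mon_Nil)
qed (intro lin_intros)+

lemma qmul_one_right [simp]: "x \<star> 1 = x"
proof (rule lin_eq_mon_revI[of "\<lambda>x. x \<star> 1" "\<lambda>x. x"])
  show "mon (rev u) \<star> 1 = mon (rev u)" for u
    using qmul_mon[of u "[]"] by (simp add: mon_Nil)
qed (intro lin_intros)+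

section \<open>Skew derivations, constant term and degree\<close>

definition skew :: "idx \<Rightarrow> (idx word \<Rightarrow>\<^sub>0 'k::field) \<Rightarrow> (idx word \<Rightarrow>\<^sub>0 'k)"
  where "skew i = lext (\<lambda>w. case rev (letters w) of [] \<Rightarrow> 0
           | j # u \<Rightarrow> if i = j then mon (rev u) else 0)"

lemma lin_skew [lin_intros]: "lin f \<Longrightarrow> lin (\<lambda>x. skew i (f x))"
  unfolding skew_def by (rule lin_comp[OF lin_lext])

lemmas skew_lin_simps [simp] = lin_add[OF lin_skew[OF lin_ident]] lin_scal[OF lin_skew[OF lin_ident]]
  lin_zero[OF lin_skew[OF lin_ident]]

lemma skew_one [simp]: "skew i 1 = 0"
  by (simp add: skew_def mon_Nil[symmetric]) (simp add: mon_def)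

lemma skew_snoc [simp]: "skew i (x * gen j) = (if i = j then x else 0)"
proof (rule lin_eq_monI[of "\<lambda>x. skew i (x * gen j)" "\<lambda>x. if i = j then x else 0"])
  show "skew i (mon u * gen j) = (if i = j then mon u else 0)" for u
    by (simp add: mon_snoc[symmetric]) (simp add: mon_def skew_def)
qed (intro lin_intros)+

lemma skew_gen [simp]: "skew i (gen j) = (if i = j then 1 else 0)"
  using skew_snoc[of i 1 j] by simp

text \<open>The augmentation, with its value kept in the algebra as a multiple of \<open>1\<close>,
  so that the rules for linear maps apply to it.\<close>

definition const :: "(idx word \<Rightarrow>\<^sub>0 'k::field) \<Rightarrow> (idx word \<Rightarrow>\<^sub>0 'k)"
  where "const = lext (\<lambda>w. if w = 0 then 1 else 0)"

lemma lin_const [lin_intros]: "lin f \<Longrightarrow> lin (\<lambda>x. const (f x))"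
  unfolding const_def by (rule lin_comp[OF lin_lext])

lemmas const_lin_simps [simp] = lin_add[OF lin_const[OF lin_ident]] lin_scal[OF lin_const[OF lin_ident]]
  lin_zero[OF lin_const[OF lin_ident]]

lemma const_one [simp]: "const 1 = 1"
  by (simp add: const_def flip: single_one)

lemma const_snoc [simp]: "const (x * gen i) = 0"
proof (rule lin_eq_monI[of "\<lambda>x. const (x * gen i)" "\<lambda>x. 0"])
  show "const (mon u * gen i) = 0" for u
    by (simp add: mon_snoc[symmetric]) (simp add: mon_def const_def zero_word_def)
qed (intro lin_intros)+

lemma const_gen [simp]: "const (gen i) = 0"
  using const_snoc[of 1 i] by simp

lemma decompose: "x = const x + skew V1 x * gen V1 + skew V2 x * gen V2"
proof (rule lin_eq_mon_revI[of "\<lambda>x. x" "\<lambda>x. const x + skew V1 x * gen V1 + skew V2 x * gen V2"])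
  show "mon (rev u) = const (mon (rev u)) + skew V1 (mon (rev u)) * gen V1 + skew V2 (mon (rev u)) * gen V2"
    for u
  proof (cases u)
    case Nil
    then show ?thesis by (simp add: mon_Nil)
  next
    case (Cons i v)
    then show ?thesis by (cases i) (simp_all add: mon_snoc)
  qed
qed (intro lin_intros)+

text \<open>A word is empty or ends in exactly one of the two letters, so these three pieces
  determine an element. Equalities in the shuffle algebra thereby reduce to equalities in lower
  degree.\<close>

lemma skew_extI:
  assumes "const x = const y" "\<And>i. skew i x = skew i y"
  shows "x = y"
proof -
  have "x = const x + skew V1 x * gen V1 + skew V2 x * gen V2"
    by (rule decompose)
  also have "\<dots> = const y + skew V1 y * gen V1 + skew V2 y * gen V2"
    by (simp only: assms)
  also have "\<dots> = y"
    by (rule decompose[symmetric])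
  finally show ?thesis .
qed

text \<open>The length of the right factor, which multiplies the twist, turned into a linear
  operator: the Leibniz rule for \<open>skew V1\<close> can then be stated for inhomogeneous
  elements.\<close>

definition euler :: "(idx word \<Rightarrow>\<^sub>0 'k::field) \<Rightarrow> (idx word \<Rightarrow>\<^sub>0 'k)"
  where "euler = lext (\<lambda>w. scal (of_nat (length (letters w))) (Poly_Mapping.single w 1))"

lemma lin_euler [lin_intros]: "lin f \<Longrightarrow> lin (\<lambda>x. euler (f x))"
  unfolding euler_def by (rule lin_comp[OF lin_lext])

lemmas euler_lin_simps [simp] = lin_add[OF lin_euler[OF lin_ident]] lin_scal[OF lin_euler[OF lin_ident]]
  lin_zero[OF lin_euler[OF lin_ident]]

lemma euler_one [simp]: "euler 1 = 0"
  by (simp add: euler_def zero_word_def flip: single_one)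

lemma euler_mon: "euler (mon u) = scal (of_nat (length u)) (mon u)"
  by (simp add: euler_def mon_def)

lemma euler_snoc [simp]: "euler (x * gen i) = euler x * gen i + x * gen i"
proof (rule lin_eq_monI[of "\<lambda>x. euler (x * gen i)" "\<lambda>x. euler x * gen i + x * gen i"])
  show "euler (mon u * gen i) = euler (mon u) * gen i + mon u * gen i" for u
    by (simp add: mon_snoc[symmetric] euler_mon vec.scale_left_distrib add.commute)
qed (intro lin_intros)+

lemma euler_gen [simp]: "euler (gen i) = gen i"
  using euler_snoc[of 1 i] by simp

lemma euler_tw: "euler (x * tw i k) = euler x * tw i k + x * tw i k"
  by (cases i) (simp_all add: distrib_left add_ac vec.scale_right_distrib)

lemma euler_shr: "euler (shr u v) = scal (of_nat (length u + length v)) (shr u v)"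
proof (induction u v rule: shr.induct)
  case (3 i u j v)
  define c :: 'a where "c = of_nat (length u + length v) + 1"
  have "of_nat (length (i # u) + length (j # v)) = c + 1"
    by (simp add: c_def)
  moreover have "euler (shr u (j # v)) = scal c (shr u (j # v))"
    "euler (shr (i # u) v) = scal c (shr (i # u) v)"
    using 3 by (simp_all add: c_def add_ac)
  ultimately show ?case
    by (simp add: euler_tw vec.scale_left_distrib vec.scale_right_distrib add_ac)
qed (simp_all add: euler_mon del: rev.simps)

section \<open>Leibniz rules for the shuffle product\<close>

lemma euler_qmul: "euler (x \<star> y) = euler x \<star> y + x \<star> euler y"
proof (rule lin_eq_mon_revI[of "\<lambda>x. euler (x \<star> y)" "\<lambda>x. euler x \<star> y + x \<star> euler y"])
  fix u
  show "euler (mon (rev u) \<star> y) = euler (mon (rev u)) \<star> y + mon (rev u) \<star> euler y"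
  proof (rule lin_eq_mon_revI[of "\<lambda>y. euler (mon (rev u) \<star> y)"
        "\<lambda>y. euler (mon (rev u)) \<star> y + mon (rev u) \<star> euler y"])
    show "euler (mon (rev u) \<star> mon (rev v)) =
        euler (mon (rev u)) \<star> mon (rev v) + mon (rev u) \<star> euler (mon (rev v))" for v
      by (simp add: euler_mon qmul_lin_simps qmul_mon euler_shr vec.scale_left_distrib)
  qed (intro lin_intros)+
qed (intro lin_intros)+

lemma const_qmul: "const (x \<star> y) = const x * const y"
proof (rule lin_eq_mon_revI[of "\<lambda>x. const (x \<star> y)" "\<lambda>x. const x * const y"])
  fix u
  show "const (mon (rev u) \<star> y) = const (mon (rev u)) * const y"
  proof (rule lin_eq_mon_revI[of "\<lambda>y. const (mon (rev u) \<star> y)" "\<lambda>y. const (mon (rev u)) * const y"])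
    show "const (mon (rev u) \<star> mon (rev v)) = const (mon (rev u)) * const (mon (rev v))" for v
    proof (cases u)
      case (Cons i u')
      then show ?thesis
        by (cases v; cases i) (simp_all add: qmul_mon mon_snoc mon_Nil distrib_left del: rev.simps, simp_all add: mon_snoc)
    qed (simp add: mon_Nil)
  qed (intro lin_intros)+
qed (intro lin_intros)+

text \<open>The twist of \<open>V2\<close> only adds a multiple of \<open>gen V1\<close>, so it is
  invisible to \<open>skew V2\<close>.\<close>

lemma skew_V2_qmul: "skew V2 (x \<star> y) = x \<star> skew V2 y + skew V2 x \<star> y"
proof (rule lin_eq_mon_revI[of "\<lambda>x. skew V2 (x \<star> y)" "\<lambda>x. x \<star> skew V2 y + skew V2 x \<star> y"])
  fix u
  show "skew V2 (mon (rev u) \<star> y) = mon (rev u) \<star> skew V2 y + skew V2 (mon (rev u)) \<star> y"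
  proof (rule lin_eq_mon_revI[of "\<lambda>y. skew V2 (mon (rev u) \<star> y)"
        "\<lambda>y. mon (rev u) \<star> skew V2 y + skew V2 (mon (rev u)) \<star> y"])
    show "skew V2 (mon (rev u) \<star> mon (rev v)) =
        mon (rev u) \<star> skew V2 (mon (rev v)) + skew V2 (mon (rev u)) \<star> mon (rev v)" for v
    proof (cases "u = [] \<or> v = []")
      case True
      then show ?thesis by (auto simp: mon_Nil qmul_lin_simps)
    next
      case False
      then obtain i u' j v' where [simp]: "u = i # u'" "v = j # v'"
        by (meson neq_Nil_conv)
      have [simp]: "skew V2 (mon (rev u)) = (if i = V2 then mon (rev u') else 0)"
        "skew V2 (mon (rev v)) = (if j = V2 then mon (rev v') else 0)"
        by (simp_all add: mon_snoc)
      show ?thesis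
        unfolding qmul_mon \<open>skew V2 (mon (rev u)) = _\<close> \<open>skew V2 (mon (rev v)) = _\<close>
        by (cases i; cases j)
          (simp_all add: qmul_mon qmul_lin_simps distrib_left del: rev.simps)
    qed
  qed (intro lin_intros)+
qed (intro lin_intros)+

text \<open>When the last letter of the product is a \<open>V2\<close> from the left factor, all
  letters of the right factor have acted on it and contributed one \<open>gen V1\<close> each; this
  is the last summand.\<close>

lemma skew_V1_qmul:
  "skew V1 (x \<star> y) = x \<star> skew V1 y + skew V1 x \<star> y + skew V2 x \<star> euler y"
proof (rule lin_eq_mon_revI[of "\<lambda>x. skew V1 (x \<star> y)"
      "\<lambda>x. x \<star> skew V1 y + skew V1 x \<star> y + skew V2 x \<star> euler y"])
  fix u
  show "skew V1 (mon (rev u) \<star> y) = mon (rev u) \<star> skew V1 y + skew V1 (mon (rev u)) \<star> y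
      + skew V2 (mon (rev u)) \<star> euler y"
  proof (rule lin_eq_mon_revI[of "\<lambda>y. skew V1 (mon (rev u) \<star> y)"
        "\<lambda>y. mon (rev u) \<star> skew V1 y + skew V1 (mon (rev u)) \<star> y + skew V2 (mon (rev u)) \<star> euler y"])
    show "skew V1 (mon (rev u) \<star> mon (rev v)) =
        mon (rev u) \<star> skew V1 (mon (rev v)) + skew V1 (mon (rev u)) \<star> mon (rev v)
        + skew V2 (mon (rev u)) \<star> euler (mon (rev v))" for v
    proof (cases "u = [] \<or> v = []")
      case True
      then show ?thesis
        by (auto simp: mon_Nil qmul_lin_simps)
    next
      case False
      then obtain i u' j v' where [simp]: "u = i # u'" "v = j # v'"
        by (meson neq_Nil_conv)
      have *: "skew l (mon (rev u)) = (if i = l then mon (rev u') else 0)"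
        "skew l (mon (rev v)) = (if j = l then mon (rev v') else 0)" for l
        by (auto simp add: mon_snoc)
      show ?thesis
        unfolding qmul_mon *
        by (cases i; cases j)
          (simp_all add: qmul_mon qmul_lin_simps euler_mon distrib_left del: rev.simps)
    qed
  qed (intro lin_intros)+
qed (intro lin_intros)+

text \<open>Both bracketings have the same constant term and, by the Leibniz rules, skew derivatives
  that agree by induction on the total length. The twist terms match because \<open>euler\<close> is
  itself a derivation of the product.\<close>

lemma qmul_assoc_mon:
  "length u + length v + length w = n \<Longrightarrow>
    ((mon (rev u) :: idx word \<Rightarrow>\<^sub>0 'k::field) \<star> mon (rev v)) \<star> mon (rev w) =
      mon (rev u) \<star> (mon (rev v) \<star> mon (rev w))"
proof (induction n arbitrary: u v w rule: less_induct)
  case (less n)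
  let ?m = "\<lambda>t. mon (rev t) :: idx word \<Rightarrow>\<^sub>0 'k"
  let ?U = "?m u" and ?V = "?m v" and ?W = "?m w"
  \<comment> \<open>The induction hypothesis speaks of words only, so it matters that a skew
    derivative of a word is zero or a shorter word.\<close>
  have skew_mon: "skew i (?m t) = 0 \<or> (\<exists>t'. length t' < length t \<and> skew i (?m t) = ?m t')"
    for i and t :: "idx list"
    by (cases t) (auto simp: mon_Nil mon_snoc)
  have 1: "(skew i ?U \<star> ?V) \<star> ?W = skew i ?U \<star> (?V \<star> ?W)" for i
    using skew_mon[of i u] less.prems by (auto simp: qmul_lin_simps intro!: less.IH[OF _ refl])
  have 2: "(?U \<star> skew i ?V) \<star> ?W = ?U \<star> (skew i ?V \<star> ?W)" for i
    using skew_mon[of i v] less.prems by (auto simp: qmul_lin_simps intro!: less.IH[OF _ refl])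
  have 3: "(?U \<star> ?V) \<star> skew i ?W = ?U \<star> (?V \<star> skew i ?W)" for i
    using skew_mon[of i w] less.prems by (auto simp: qmul_lin_simps intro!: less.IH[OF _ refl])
  show ?case
  proof (rule skew_extI)
    show "const (?U \<star> ?V \<star> ?W) = const (?U \<star> (?V \<star> ?W))"
      by (simp add: const_qmul mult.assoc)
    show "skew i (?U \<star> ?V \<star> ?W) = skew i (?U \<star> (?V \<star> ?W))" for i
      by (cases i)
        (simp_all add: skew_V1_qmul skew_V2_qmul euler_qmul euler_mon qmul_lin_simps 1 2 3 algebra_simps)
  qed
qed

lemma qmul_assoc: "(x \<star> y) \<star> z = x \<star> (y \<star> z)"
proof (rule lin_eq_mon_revI[of "\<lambda>x. (x \<star> y) \<star> z" "\<lambda>x. x \<star> (y \<star> z)"])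
  fix u
  show "(mon (rev u) \<star> y) \<star> z = mon (rev u) \<star> (y \<star> z)"
  proof (rule lin_eq_mon_revI[of "\<lambda>y. (mon (rev u) \<star> y) \<star> z" "\<lambda>y. mon (rev u) \<star> (y \<star> z)"])
    fix v
    show "(mon (rev u) \<star> mon (rev v)) \<star> z = mon (rev u) \<star> (mon (rev v) \<star> z)"
      by (rule lin_eq_mon_revI[of "\<lambda>z. (mon (rev u) \<star> mon (rev v)) \<star> z"
            "\<lambda>z. mon (rev u) \<star> (mon (rev v) \<star> z)"], (intro lin_intros)+, rule qmul_assoc_mon[OF refl])
  qed (intro lin_intros)+
qed (intro lin_intros)+


section \<open>The quantum symmetrizer\<close>

fun qsym_word :: "idx list \<Rightarrow> (idx word \<Rightarrow>\<^sub>0 'k::field)"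
  where
    "qsym_word [] = 1"
  | "qsym_word (i # u) = gen i \<star> qsym_word u"

text \<open>Its kernel is the ideal of relations of the Nichols algebra: \<open>proj\<close> is this
  map followed by an injective one.\<close>

definition qsym :: "(idx word \<Rightarrow>\<^sub>0 'k::field) \<Rightarrow> (idx word \<Rightarrow>\<^sub>0 'k)"
  where "qsym = lext (\<lambda>w. qsym_word (letters w))"

lemma lin_qsym [lin_intros]: "lin f \<Longrightarrow> lin (\<lambda>x. qsym (f x))"
  unfolding qsym_def by (rule lin_comp[OF lin_lext])

lemmas qsym_lin_simps [simp] = lin_add[OF lin_qsym[OF lin_ident]] lin_scal[OF lin_qsym[OF lin_ident]]
  lin_zero[OF lin_qsym[OF lin_ident]] lin_diff[OF lin_qsym[OF lin_ident]]

lemma qsym_mon: "qsym (mon u) = qsym_word u"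
  by (simp add: qsym_def mon_def)

lemma qsym_one [simp]: "qsym 1 = 1"
  using qsym_mon[of "[]"] by (simp add: mon_Nil)

lemma qsym_gen [simp]: "qsym (gen i) = gen i"
  by (simp add: gen_mon qsym_mon)

lemma qsym_mult: "qsym (x * y) = qsym x \<star> qsym y"
proof (rule lin_eq_monI[of "\<lambda>x. qsym (x * y)" "\<lambda>x. qsym x \<star> qsym y"])
  fix u
  show "qsym (mon u * y) = qsym (mon u) \<star> qsym y"
  proof (rule lin_eq_monI[of "\<lambda>y. qsym (mon u * y)" "\<lambda>y. qsym (mon u) \<star> qsym y"])
    show "qsym (mon u * mon v) = qsym (mon u) \<star> qsym (mon v)" for v
      unfolding mon_append[symmetric] qsym_mon by (induction u) (simp_all add: qmul_assoc)
  qed (intro lin_intros)+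
qed (intro lin_intros)+

text \<open>A single letter has degree one, so \<open>euler\<close> fixes it and the twist term is
  \<open>skew V2 (qsym x)\<close> times that letter.\<close>

lemma skew_qsym_snoc:
  "skew V1 (qsym (x * gen i)) = (if i = V1 then qsym x else 0) + skew V1 (qsym x) \<star> gen i
    + skew V2 (qsym x) \<star> gen i"
  "skew V2 (qsym (x * gen i)) = (if i = V2 then qsym x else 0) + skew V2 (qsym x) \<star> gen i"
  by (simp_all add: qsym_mult skew_V1_qmul skew_V2_qmul qmul_lin_simps)

lemma const_qsym_snoc: "const (qsym (x * gen i)) = 0"
  by (simp add: qsym_mult const_qmul)

section \<open>Skew derivatives of powers of the generators\<close>

lemma skew_qsym_a:
  "skew V1 (qsym ((gen V1 :: idx word \<Rightarrow>\<^sub>0 'k::field) ^ Suc m)) = scal (of_nat (Suc m)) (qsym (gen V1 ^ m))"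
  "skew V2 (qsym ((gen V1 :: idx word \<Rightarrow>\<^sub>0 'k) ^ m)) = 0"
proof -
  let ?a = "gen V1 :: idx word \<Rightarrow>\<^sub>0 'k"
  show 2: "skew V2 (qsym (?a ^ m)) = 0" for m
    by (induction m) (simp_all add: power_Suc2 skew_qsym_snoc qmul_lin_simps del: power_Suc)
  show "skew V1 (qsym (?a ^ Suc m)) = scal (of_nat (Suc m)) (qsym (?a ^ m))"
  proof (induction m)
    case (Suc m)
    have "skew V1 (qsym (?a ^ Suc (Suc m))) =
        qsym (?a ^ Suc m) + skew V1 (qsym (?a ^ Suc m)) \<star> ?a"
      by (subst power_Suc2) (simp add: skew_qsym_snoc 2 qmul_lin_simps del: power_Suc)
    also have "skew V1 (qsym (?a ^ Suc m)) \<star> ?a = scal (of_nat (Suc m)) (qsym (?a ^ Suc m))"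
      by (subst Suc) (simp add: qmul_lin_simps power_Suc2 qsym_mult del: power_Suc of_nat_Suc)
    finally show ?case
      by (simp add: of_nat_Suc[of "Suc m"] vec.scale_left_distrib del: power_Suc of_nat_Suc)
  qed simp
qed

text \<open>Passing to the next power adds the twist term, whose coefficient is the current
  exponent; summing the exponents 1, ..., m gives the binomial coefficient.\<close>

lemma skew_qsym_b:
  "skew V2 (qsym ((gen V2 :: idx word \<Rightarrow>\<^sub>0 'k::field) ^ Suc m)) = scal (of_nat (Suc m)) (qsym (gen V2 ^ m))"
  "skew V1 (qsym ((gen V2 :: idx word \<Rightarrow>\<^sub>0 'k) ^ Suc m)) = scal (of_nat (Suc m choose 2)) (qsym (gen V2 ^ m))"
proof -
  let ?b = "gen V2 :: idx word \<Rightarrow>\<^sub>0 'k"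
  show 2: "skew V2 (qsym (?b ^ Suc m)) = scal (of_nat (Suc m)) (qsym (?b ^ m))" for m
  proof (induction m)
    case (Suc m)
    have "skew V2 (qsym (?b ^ Suc (Suc m))) =
        qsym (?b ^ Suc m) + skew V2 (qsym (?b ^ Suc m)) \<star> ?b"
      by (subst power_Suc2) (simp add: skew_qsym_snoc qmul_lin_simps del: power_Suc)
    also have "skew V2 (qsym (?b ^ Suc m)) \<star> ?b = scal (of_nat (Suc m)) (qsym (?b ^ Suc m))"
      by (subst Suc) (simp add: qmul_lin_simps power_Suc2 qsym_mult del: power_Suc of_nat_Suc)
    finally show ?case
      by (simp add: of_nat_Suc[of "Suc m"] vec.scale_left_distrib del: power_Suc of_nat_Suc)
  qed simp
  show "skew V1 (qsym (?b ^ Suc m)) = scal (of_nat (Suc m choose 2)) (qsym (?b ^ m))"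
  proof (induction m)
    case (Suc m)
    have "skew V1 (qsym (?b ^ Suc (Suc m))) =
        skew V1 (qsym (?b ^ Suc m)) \<star> ?b + skew V2 (qsym (?b ^ Suc m)) \<star> ?b"
      by (subst power_Suc2) (simp add: skew_qsym_snoc qmul_lin_simps del: power_Suc)
    also have "\<dots> = scal (of_nat ((Suc m choose 2) + Suc m)) (qsym (?b ^ Suc m))"
      unfolding Suc 2 qmul_lin_simps
      by (simp only: power_Suc2[of ?b m] qsym_mult[of "?b ^ m"] qsym_gen
          of_nat_add vec.scale_left_distrib)
    also have "(Suc m choose 2) + Suc m = Suc (Suc m) choose 2"
      using binomial_Suc_Suc[of "Suc m" 1] by (simp only: choose_one Suc_1 add.commute)
    finally show ?case .
  qed (simp add: binomial_eq_0)
qed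

section \<open>Linear independence of the ordered monomials\<close>

lemma funpow_skew_zero [simp]: "(skew i ^^ m) 0 = 0"
  by (induction m) simp_all

lemma lin_funpow_skew [lin_intros]: "lin f \<Longrightarrow> lin (\<lambda>x. (skew i ^^ m) (f x))"
proof (induction m)
  case (Suc m)
  then show ?case using lin_skew[of "\<lambda>x. (skew i ^^ m) (f x)" i] by simp
qed simp

lemmas funpow_skew_scal = lin_scal[OF lin_funpow_skew[OF lin_ident]]

lemma const_funpow_skew_V1:
  "const ((skew V1 ^^ m) (qsym ((gen V1 :: idx word \<Rightarrow>\<^sub>0 'k::field) ^ i))) =
    (if i = m then scal (of_nat (fact m)) 1 else 0)"
proof (induction m arbitrary: i)
  case 0
  then show ?case
    by (cases i) (simp_all add: power_Suc2 const_qsym_snoc del: power_Suc)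
next
  case (Suc m)
  show ?case
  proof (cases i)
    case (Suc k)
    have "(skew V1 ^^ Suc m) (qsym ((gen V1 :: idx word \<Rightarrow>\<^sub>0 'k) ^ i))
        = scal (of_nat (Suc k)) ((skew V1 ^^ m) (qsym (gen V1 ^ k)))"
      by (simp only: Suc funpow_Suc_right o_apply skew_qsym_a funpow_skew_scal)
    then show ?thesis using Suc.IH[of k] Suc by (simp add: algebra_simps del: power_Suc funpow.simps)
  qed (simp add: funpow_Suc_right del: funpow.simps)
qed

text \<open>\<open>skew V2\<close> kills powers of \<open>gen V1\<close>, so by the Leibniz rule it
  differentiates only the right factor. For \<open>j > m\<close> a positive power of
  \<open>gen V2\<close> would survive, hence the bound.\<close>

lemma funpow_skew_V2:
  "j \<le> m \<Longrightarrow> (skew V2 ^^ m) (qsym ((gen V1 :: idx word \<Rightarrow>\<^sub>0 'k::field) ^ i * gen V2 ^ j)) =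
    (if j = m then scal (of_nat (fact m)) (qsym (gen V1 ^ i)) else 0)"
proof (induction m arbitrary: j)
  case (Suc m)
  show ?case
  proof (cases j)
    case 0
    then show ?thesis
      by (simp add: funpow_Suc_right skew_qsym_a del: funpow.simps)
  next
    case (Suc k)
    have "(skew V2 ^^ Suc m) (qsym ((gen V1 :: idx word \<Rightarrow>\<^sub>0 'k) ^ i * gen V2 ^ j))
        = scal (of_nat (Suc k)) ((skew V2 ^^ m) (qsym (gen V1 ^ i * gen V2 ^ k)))"
      by (simp only: Suc funpow_Suc_right o_apply qsym_mult skew_V2_qmul skew_qsym_a skew_qsym_b
          qmul_lin_simps funpow_skew_scal add_0_right)
    then show ?thesis using Suc.IH[of k] Suc Suc.prems by (simp add: algebra_simps del: power_Suc funpow.simps)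
  qed
qed simp

lemma qsym_monomials_independent:
  fixes c :: "nat \<times> nat \<Rightarrow> 'k::field"
  assumes fact: "\<And>m. m < p \<Longrightarrow> of_nat (fact m) \<noteq> (0 :: 'k)"
    and zero: "(\<Sum>(i, j)\<in>{..<p} \<times> {..<p}. scal (c (i, j)) (qsym (gen V1 ^ i * gen V2 ^ j))) = 0"
  shows "\<forall>ij\<in>{..<p} \<times> {..<p}. c ij = 0"
proof (rule ccontr)
  let ?A = "{..<p} \<times> {..<p}"
  \<comment> \<open>The functional is aimed at a term of maximal exponent in \<open>gen V2\<close>:
    terms with a smaller exponent die under \<open>skew V2 ^^ J\<close>, and terms with a larger one
    have coefficient zero.\<close>
  define K where "K = {j. \<exists>i. (i, j) \<in> ?A \<and> c (i, j) \<noteq> 0}"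
  assume "\<not> (\<forall>ij\<in>?A. c ij = 0)"
  then have "K \<noteq> {}" unfolding K_def by auto
  have "finite K" by (rule finite_subset[of _ "{..<p}"]) (auto simp: K_def)
  define J where "J = Max K"
  have "J \<in> K" using \<open>K \<noteq> {}\<close> \<open>finite K\<close> by (simp add: J_def)
  then obtain I where IJ: "I < p" "J < p" "c (I, J) \<noteq> 0" by (auto simp: K_def)
  have top: "c (i, j) = 0" if "i < p" "j < p" "J < j" for i j
    using that Max_ge[OF \<open>finite K\<close>, of j] unfolding K_def J_def by fastforce
  define F :: "(idx word \<Rightarrow>\<^sub>0 'k) \<Rightarrow> (idx word \<Rightarrow>\<^sub>0 'k)"
    \<comment> \<open>Once \<open>gen V2\<close> is removed, only pure powers of
      \<open>gen V1\<close> are left for \<open>skew V1\<close>. The outcome is the coefficient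
      times \<open>I! * J!\<close>, nonzero because both exponents are below
      \<open>p\<close>.\<close>
    where "F = (\<lambda>x. const ((skew V1 ^^ I) ((skew V2 ^^ J) x)))"
  have lin: "lin F" unfolding F_def by (intro lin_intros)
  have F: "scal (c (i, j)) (F (qsym (gen V1 ^ i * gen V2 ^ j))) =
      (if (i, j) = (I, J) then scal (c (I, J) * (of_nat (fact I) * of_nat (fact J))) 1 else 0)" if "i < p" "j < p" for i j
  proof (cases "j \<le> J")
    case True
    then show ?thesis
      by (simp add: F_def funpow_skew_V2 funpow_skew_scal const_funpow_skew_V1 mult_ac)
  qed (use top[OF that] in auto)
  have "0 = F (\<Sum>(i, j)\<in>?A. scal (c (i, j)) (qsym (gen V1 ^ i * gen V2 ^ j)))"
    by (simp only: zero lin_zero[OF lin])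
  also have "\<dots> = (\<Sum>ij\<in>?A. if ij = (I, J) then scal (c (I, J) * (of_nat (fact I) * of_nat (fact J))) 1 else 0)"
    using F by (subst lin_sum[OF lin]) (rule sum.cong[OF refl], clarsimp simp: lin_scal[OF lin])
  also have "\<dots> = scal (c (I, J) * (of_nat (fact I) * of_nat (fact J))) 1"
    using IJ by simp
  finally show False
    using IJ fact by (auto simp: vec.scale_eq_0_iff dest: sym)
qed

text \<open>Twice the binomial coefficient is p (p - 1), and 2 is invertible. This is what makes
  \<open>skew V1\<close> kill the p-th power of \<open>gen V2\<close>.\<close>

lemma of_nat_CHAR_choose_two:
  assumes "CHAR('k::field) > 2"
  shows "of_nat (CHAR('k) choose 2) = (0 :: 'k)"
proof -
  let ?p = "CHAR('k)"
  have "2 * (?p choose 2) = ?p * (?p - 1)"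
    unfolding choose_two by (rule dvd_mult_div_cancel) (cases ?p, simp_all)
  then have "(2 :: 'k) * of_nat (?p choose 2) = of_nat ?p * of_nat (?p - 1)"
    by (metis of_nat_mult of_nat_numeral)
  moreover have "of_nat 2 \<noteq> (0 :: 'k)"
    using assms by (subst of_nat_eq_0_iff_char_dvd) (auto dest: dvd_imp_le)
  ultimately show ?thesis by simp
qed

lemma qsym_relations:
  assumes "CHAR('k::field) = p" "p > 2"
  shows "qsym (gen V1 ^ p :: idx word \<Rightarrow>\<^sub>0 'k) = 0"
    and "qsym (gen V2 ^ p :: idx word \<Rightarrow>\<^sub>0 'k) = 0"
    and "qsym (gen V2 * gen V1 - gen V1 * gen V2 - scal (1 / 2) (gen V1 ^ 2) :: idx word \<Rightarrow>\<^sub>0 'k) = 0"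
proof -
  obtain m where m: "p = Suc m" using assms(2) by (cases p) auto
  have p: "of_nat (Suc m) = (0 :: 'k)" using m assms(1) of_nat_CHAR by metis
  have p2: "of_nat (Suc m choose 2) = (0 :: 'k)"
    using of_nat_CHAR_choose_two[where 'k = 'k] assms m by simp
  have const: "const (qsym (gen i ^ p)) = 0" for i
    by (simp only: m power_Suc2 const_qsym_snoc)
  show "qsym (gen V1 ^ p :: idx word \<Rightarrow>\<^sub>0 'k) = 0"
  proof (rule skew_extI)
    show "skew i (qsym (gen V1 ^ p :: idx word \<Rightarrow>\<^sub>0 'k)) = skew i 0" for i
      by (cases i) (simp_all only: m skew_qsym_a p, simp_all)
  qed (simp add: const)
  show "qsym (gen V2 ^ p :: idx word \<Rightarrow>\<^sub>0 'k) = 0"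
  proof (rule skew_extI)
    show "skew i (qsym (gen V2 ^ p :: idx word \<Rightarrow>\<^sub>0 'k)) = skew i 0" for i
      by (cases i) (simp_all only: m skew_qsym_b p p2, simp_all)
  qed (simp add: const)
  have two: "(2 :: 'k) \<noteq> 0"
    using assms of_nat_eq_0_iff_char_dvd[where 'a = 'k, of 2] by (auto dest: dvd_imp_le)
  \<comment> \<open>\<open>skew V1\<close> of the square of \<open>gen V1\<close> is
    \<open>gen V1 + gen V1\<close>; half of it cancels the twist term of
    \<open>gen V2 * gen V1\<close>.\<close>
  have scal2: "scal (1 / 2) (x + x) = x" for x :: "idx word \<Rightarrow>\<^sub>0 'k"
    using two vec.scale_left_distrib[of "1 / 2" "1 / 2" x] by (simp add: vec.scale_right_distrib)
  show "qsym (gen V2 * gen V1 - gen V1 * gen V2 - scal (1 / 2) (gen V1 ^ 2) :: idx word \<Rightarrow>\<^sub>0 'k) = 0"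
  proof (rule skew_extI)
    show "const (qsym (gen V2 * gen V1 - gen V1 * gen V2 - scal (1 / 2) (gen V1 ^ 2) :: idx word \<Rightarrow>\<^sub>0 'k)) = const 0"
      by (simp add: lin_diff[OF lin_const[OF lin_ident]] const_qsym_snoc power2_eq_square)
    show "skew i (qsym (gen V2 * gen V1 - gen V1 * gen V2 - scal (1 / 2) (gen V1 ^ 2) :: idx word \<Rightarrow>\<^sub>0 'k)) = skew i 0" for i
      by (cases i)
        (simp_all add: lin_diff[OF lin_skew[OF lin_ident]] power2_eq_square skew_qsym_snoc scal2 qmul_lin_simps)
  qed
qed


section \<open>Ideals of the tensor algebra\<close>

lemma ring_of_type_algebra_simps [simp]:
  "carrier ring_of_type_algebra = UNIV"
  "x \<otimes>\<^bsub>ring_of_type_algebra\<^esub> y = x * y"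
  "x \<oplus>\<^bsub>ring_of_type_algebra\<^esub> y = x + y"
  "\<one>\<^bsub>ring_of_type_algebra\<^esub> = 1"
  "\<zero>\<^bsub>ring_of_type_algebra\<^esub> = 0"
  by (simp_all add: ring_of_type_algebra_def)

lemma ring_tensor_ring: "ring (ring_of_type_algebra :: 'a::ring_1 ring)"
proof (rule ringI)
  show "abelian_group (ring_of_type_algebra :: 'a ring)"
  proof (rule abelian_groupI)
    show "\<exists>y\<in>carrier ring_of_type_algebra. y \<oplus>\<^bsub>ring_of_type_algebra\<^esub> x = \<zero>\<^bsub>ring_of_type_algebra\<^esub>" for x :: 'a
      by (auto intro!: exI[of _ "- x"])
  qed (simp_all add: add_ac)
  show "monoid (ring_of_type_algebra :: 'a ring)"
    by (rule monoidI) (simp_all add: mult.assoc)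
qed (simp_all add: distrib_left distrib_right)

lemma ideal_type_algebra:
  fixes J :: "'a::ring_1 set"
  assumes "ideal J ring_of_type_algebra"
  shows "0 \<in> J" "x \<in> J \<Longrightarrow> y \<in> J \<Longrightarrow> x + y \<in> J" "x \<in> J \<Longrightarrow> y * x \<in> J" "x \<in> J \<Longrightarrow> x * y \<in> J"
proof -
  interpret ideal J "ring_of_type_algebra :: 'a ring" by fact
  show "0 \<in> J" using additive_subgroup.zero_closed[OF is_additive_subgroup] by simp
  show "x \<in> J \<Longrightarrow> y \<in> J \<Longrightarrow> x + y \<in> J" using additive_subgroup.a_closed[OF is_additive_subgroup] by simp
  show "x \<in> J \<Longrightarrow> y * x \<in> J" using I_l_closed[of x y] by simp
  show "x \<in> J \<Longrightarrow> x * y \<in> J" using I_r_closed[of x y] by simp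
qed

text \<open>Scaling is multiplication by an element of the ring, so ideals are closed under
  it.\<close>

lemma subspace_ideal:
  assumes "ideal J (ring_of_type_algebra :: ('x::monoid_add \<Rightarrow>\<^sub>0 'k::field) ring)"
  shows "vec.subspace J"
  using ideal_type_algebra[OF assms] by (auto simp: vec.subspace_def scal_conv_times)

text \<open>Modulo the ideal, the commutator with \<open>b\<close> is a derivation sending
  \<open>a\<close> to half of its square, hence the i-th power of \<open>a\<close> to i/2 times the
  next one.\<close>

lemma commute_power_mod_ideal:
  fixes J :: "('x word \<Rightarrow>\<^sub>0 'k::field) set"
  assumes J: "ideal J ring_of_type_algebra" and rel: "b * a - a * b - scal (1 / 2) (a ^ 2) \<in> J"
  shows "b * a ^ i - a ^ i * b - scal (of_nat i / 2) (a ^ Suc i) \<in> J"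
proof (induction i)
  case 0
  then show ?case using ideal_type_algebra(1)[OF J] by simp
next
  case (Suc i)
  \<comment> \<open>Move \<open>b\<close> past the first \<open>i\<close> factors \<open>a\<close>,
    then past the last one.\<close>
  have "b * a ^ Suc i - a ^ Suc i * b - scal (of_nat (Suc i) / 2) (a ^ Suc (Suc i)) =
    (b * a ^ i - a ^ i * b - scal (of_nat i / 2) (a ^ Suc i)) * a
      + a ^ i * (b * a - a * b - scal (1 / 2) (a ^ 2))"
    by (simp add: power_Suc2 left_diff_distrib right_diff_distrib mult.assoc power2_eq_square
        vec.scale_left_distrib add_divide_distrib del: power_Suc)
  then show ?case
    using ideal_type_algebra[OF J] Suc rel by metis
qed

text \<open>The span contains \<open>1\<close> and is stable under left multiplication by both
  letters, so it contains every word.\<close>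

lemma span_monomials_ideal:
  fixes J :: "(idx word \<Rightarrow>\<^sub>0 'k::field) set"
  assumes J: "ideal J ring_of_type_algebra" and "p > 0"
    and rels: "gen V1 ^ p \<in> J" "gen V2 ^ p \<in> J"
      "gen V2 * gen V1 - gen V1 * gen V2 - scal (1 / 2) (gen V1 ^ 2) \<in> J"
  shows "vec.span ((\<lambda>(i, j). gen V1 ^ i * gen V2 ^ j) ` ({..<p} \<times> {..<p}) \<union> J) = UNIV"
proof -
  let ?f = "\<lambda>(i, j). gen V1 ^ i * gen V2 ^ j :: idx word \<Rightarrow>\<^sub>0 'k"
  define U where "U = vec.span (?f ` ({..<p} \<times> {..<p}) \<union> J)"
  have JU: "x \<in> J \<Longrightarrow> x \<in> U" for x by (simp add: U_def vec.span_base)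
  have U: "vec.subspace U" by (simp add: U_def)
  have f: "gen V1 ^ i * gen V2 ^ j \<in> U" if "i \<le> p" "j \<le> p" for i j
  proof (cases "i = p \<or> j = p")
    case True
    then show ?thesis using ideal_type_algebra(3,4)[OF J] rels by (auto intro!: JU)
  next
    case False
    then have "?f (i, j) \<in> U" unfolding U_def
      using that by (intro vec.span_base UnI1 imageI) auto
    then show ?thesis by simp
  qed
  have step: "gen l * x \<in> U" if "x \<in> U" for l x
  proof -
    have "vec.subspace {x. gen l * x \<in> U}"
      using U by (simp add: vec.subspace_def distrib_left)
    moreover have "x \<in> {x. gen l * x \<in> U}" if "x \<in> ?f ` ({..<p} \<times> {..<p}) \<union> J" for x
    proof (cases "x \<in> J")
      case True
      then show ?thesis using ideal_type_algebra(3)[OF J] JU by auto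
    next
      case False
      with that obtain i j where x: "x = gen V1 ^ i * gen V2 ^ j" and ij: "i < p" "j < p" by auto
      show ?thesis
      proof (cases l)
        case V1
        then have "gen l * x = gen V1 ^ Suc i * gen V2 ^ j" by (simp add: x mult.assoc)
        then show ?thesis using f[of "Suc i" j] ij by simp
      next
        case V2
        let ?r = "gen V2 * gen V1 ^ i - gen V1 ^ i * gen V2 - scal (of_nat i / 2) (gen V1 ^ Suc i)
            :: idx word \<Rightarrow>\<^sub>0 'k"
        \<comment> \<open>The commutation rule moves \<open>gen V2\<close> past the power of
          \<open>gen V1\<close>; the correction term gains one \<open>gen V1\<close>, and the error
          lies in \<open>J\<close>.\<close>
        have "gen l * x = gen V1 ^ i * gen V2 ^ Suc j
            + scal (of_nat i / 2) (gen V1 ^ Suc i * gen V2 ^ j) + ?r * gen V2 ^ j"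
          by (simp add: V2 x left_diff_distrib mult.assoc)
        moreover have "gen V1 ^ i * gen V2 ^ Suc j \<in> U" "gen V1 ^ Suc i * gen V2 ^ j \<in> U"
          using ij by (auto intro!: f simp del: power_Suc)
        moreover have "?r * gen V2 ^ j \<in> U"
          using ideal_type_algebra(4)[OF J commute_power_mod_ideal[OF J rels(3)]] by (rule JU)
        ultimately show ?thesis using U by (simp add: vec.subspace_def del: power_Suc)
      qed
    qed
    ultimately show ?thesis
      using vec.span_minimal[of _ "{x. gen l * x \<in> U}"] \<open>x \<in> U\<close> unfolding U_def by blast
  qed
  have mon: "mon u \<in> U" for u
  proof (induction u)
    case Nil
    then show ?case using f[of 0 0] by (simp add: mon_Nil)
  qed (simp add: mon_Cons step)
  have "x \<in> U" for x
  proof -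
    have "(\<Sum>s\<in>Poly_Mapping.keys x. scal (Poly_Mapping.lookup x s) (Poly_Mapping.single s 1)) \<in> U"
    proof (intro vec.subspace_sum[OF U] vec.subspace_scale[OF U])
      show "Poly_Mapping.single s 1 \<in> U" for s
        using mon[of "letters s"] by (simp add: mon_def)
    qed
    then show ?thesis by (simp only: sum_scal_keys[symmetric])
  qed
  then show ?thesis by (auto simp: U_def)
qed


section \<open>Shuffles as subsets\<close>

text \<open>The factor at position \<open>i\<close> of the summand for \<open>d\<close> in the product of the paths with arrows \<open>u\<close>
  and \<open>v\<close>.\<close>

definition shuffle_entry :: "idx list \<Rightarrow> idx list \<Rightarrow> nat set \<Rightarrow> nat \<Rightarrow> (idx word \<Rightarrow>\<^sub>0 'k::field)"
  where "shuffle_entry u v d i =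
    (if i \<in> d then tw (u ! card (d \<inter> {1..<i})) (card ({1..<i} - d)) else gen (v ! card ({1..<i} - d)))"

lemma mon_conv_prod_list: "mon u = prod_list (map (\<lambda>i. gen (u ! (i - 1))) [1..<Suc (length u)])"
proof -
  have "mon u = prod_list (map gen u)"
    by (induction u) (simp_all add: mon_Nil mon_Cons)
  also have "map gen u = map (\<lambda>i. gen (u ! (i - 1))) [1..<Suc (length u)]"
    by (rule nth_equalityI) (simp_all del: upt_Suc)
  finally show ?thesis .
qed

text \<open>Pascal's rule at the level of sets, according to whether the top position is
  chosen.\<close>

lemma subsets_Suc:
  "{d. d \<subseteq> {1..Suc q} \<and> card d = Suc m} =
    {d. d \<subseteq> {1..q} \<and> card d = Suc m} \<union> insert (Suc q) ` {d. d \<subseteq> {1..q} \<and> card d = m}"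
  (is "?L = ?R1 \<union> insert (Suc q) ` ?R2")
proof
  show "?L \<subseteq> ?R1 \<union> insert (Suc q) ` ?R2"
  proof
    fix d assume d: "d \<in> ?L"
    then have fin: "finite d" by (auto intro: finite_subset)
    show "d \<in> ?R1 \<union> insert (Suc q) ` ?R2"
    proof (cases "Suc q \<in> d")
      case True
      then have "d = insert (Suc q) (d - {Suc q})" by blast
      moreover have "d - {Suc q} \<in> ?R2"
        using d fin True by (auto simp: atLeastAtMostSuc_conv)
      ultimately show ?thesis by blast
    next
      case False
      then show ?thesis using d by (auto simp: atLeastAtMostSuc_conv)
    qed
  qed
  show "?R1 \<union> insert (Suc q) ` ?R2 \<subseteq> ?L"
  proof
    fix d assume "d \<in> ?R1 \<union> insert (Suc q) ` ?R2"
    then consider "d \<in> ?R1" | d' where "d = insert (Suc q) d'" "d' \<in> ?R2" by blast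
    then show "d \<in> ?L"
    proof cases
      case 2
      moreover have "finite d'" "Suc q \<notin> d'" using 2 by (auto intro: finite_subset)
      ultimately show ?thesis by auto
    qed auto
  qed
qed

text \<open>Whether the last position belongs to \<open>d\<close> decides which factor supplies the
  last letter, and this is the case distinction in the recursion of \<open>shr\<close>.\<close>

lemma shr_conv_sum_subsets:
  "(shr u v :: idx word \<Rightarrow>\<^sub>0 'k::field) =
    (\<Sum>d\<in>{d. d \<subseteq> {1..length u + length v} \<and> card d = length u}.
    prod_list (map (shuffle_entry (rev u) (rev v) d) [1..<Suc (length u + length v)]))"
proof (induction u v rule: shr.induct)
  case (1 v)
  have "{d. d \<subseteq> {1..length v} \<and> card d = 0} = {{}}"
    by (auto dest: finite_subset)
  then show ?case
    by (simp add: shuffle_entry_def mon_conv_prod_list[of "rev v"] del: upt_Suc)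
next
  case (2 x u)
  let ?u = "rev (x # u)"
  have "{d. d \<subseteq> {1..length ?u} \<and> card d = length ?u} = {{1..length ?u}}"
    using card_subset_eq[of "{1..length ?u}"] by auto
  moreover have "map (shuffle_entry ?u [] {1..length ?u}) [1..<Suc (length ?u)] =
      map (\<lambda>i. gen (?u ! (i - 1)) :: idx word \<Rightarrow>\<^sub>0 'k) [1..<Suc (length ?u)]"
  proof (rule map_cong[OF refl])
    fix i assume i: "i \<in> set [1..<Suc (length ?u)]"
    have *: "{1..length ?u} \<inter> {1..<i} = {1..<i}" "{1..<i} - {1..length ?u} = {}"
      using i by auto
    \<comment> \<open>No letter of the empty right word acts, so only \<open>tw _ 0\<close> occurs,
      which is seen to be \<open>gen _\<close> by cases on the letter.\<close>
    then show "shuffle_entry ?u [] {1..length ?u} i = (gen (?u ! (i - 1)) :: idx word \<Rightarrow>\<^sub>0 'k)"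
      using i unfolding shuffle_entry_def * by (cases "?u ! (i - 1)") (auto simp del: rev.simps)
  qed
  ultimately show ?case
    using mon_conv_prod_list[of ?u] by (simp del: upt_Suc rev.simps(2) map_eq_conv)
next
  case (3 x u y v)
  let ?xu = "rev (x # u)" and ?yv = "rev (y # v)" and ?q = "Suc (length u + length v)"
  let ?S = "shuffle_entry :: idx list \<Rightarrow> idx list \<Rightarrow> nat set \<Rightarrow> nat \<Rightarrow> (idx word \<Rightarrow>\<^sub>0 'k)"
  let ?D = "\<lambda>m. {d. d \<subseteq> {1..?q} \<and> card d = m}"
  have upt: "[1..<Suc (Suc ?q)] = [1..<Suc ?q] @ [Suc ?q]" by simp
  have right: "prod_list (map (?S ?xu ?yv d) [1..<Suc (Suc ?q)]) =
      prod_list (map (?S ?xu (rev v) d) [1..<Suc ?q]) * gen y"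
    if d: "d \<in> ?D (Suc (length u))" for d
  proof -
    have fin: "finite d" using d by (auto intro: finite_subset)
    have card: "card ({1..?q} - d) = length v" using d by (simp add: card_Diff_subset fin)
    have *: "?S ?xu ?yv d i = ?S ?xu (rev v) d i" if i: "i \<in> {1..?q}" for i
    proof (cases "i \<in> d")
      case False
      \<comment> \<open>The inequality is strict because position \<open>i\<close> is itself outside
        \<open>d\<close>; so the letter read at \<open>i\<close> lies in \<open>rev v\<close> and
        not in the appended \<open>y\<close>.\<close>
      have "card ({1..<i} - d) < card ({1..?q} - d)"
        using i False by (intro psubset_card_mono) auto
      then have "card ({1..<i} - d) < length v" by (simp only: card)
      then show ?thesis using False by (simp add: shuffle_entry_def nth_append)
    qed (simp add: shuffle_entry_def)
    have "map (?S ?xu ?yv d) [1..<Suc ?q] = map (?S ?xu (rev v) d) [1..<Suc ?q]"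
      by (rule map_cong[OF refl], rule *) auto
    moreover have "?S ?xu ?yv d (Suc ?q) = gen y"
    proof -
      have "Suc ?q \<notin> d" using d by auto
      moreover have "{1..<Suc ?q} - d = {1..?q} - d" by auto
      ultimately show ?thesis using card by (simp add: shuffle_entry_def nth_append)
    qed
    ultimately show ?thesis unfolding upt by (simp del: upt_Suc rev.simps map_eq_conv)
  qed
  have left: "prod_list (map (?S ?xu ?yv (insert (Suc ?q) d)) [1..<Suc (Suc ?q)]) =
      prod_list (map (?S (rev u) ?yv d) [1..<Suc ?q]) * tw x (Suc (length v))"
    if d: "d \<in> ?D (length u)" for d
  proof -
    have fin: "finite d" using d by (auto intro: finite_subset)
    have **: "?S ?xu ?yv (insert (Suc ?q) d) i = ?S (rev u) ?yv d i"
      if i: "i \<in> {1..?q}" for i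
    proof -
      have *: "insert (Suc ?q) d \<inter> {1..<i} = d \<inter> {1..<i}" "{1..<i} - insert (Suc ?q) d = {1..<i} - d"
        using i by auto
      show ?thesis
      proof (cases "i \<in> d")
        case True
        then have "card (d \<inter> {1..<i}) < card d"
          using fin by (intro psubset_card_mono) auto
        then show ?thesis
          using True d unfolding shuffle_entry_def * by (simp add: nth_append)
      next
        case False
        then have "i \<notin> insert (Suc ?q) d" using i by auto
        then show ?thesis
          using False unfolding shuffle_entry_def * by simp
      qed
    qed
    have "map (?S ?xu ?yv (insert (Suc ?q) d)) [1..<Suc ?q] = map (?S (rev u) ?yv d) [1..<Suc ?q]"
      by (rule map_cong[OF refl], rule **) auto
    moreover have "?S ?xu ?yv (insert (Suc ?q) d) (Suc ?q) = tw x (Suc (length v))"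
    proof -
      have *: "insert (Suc ?q) d \<inter> {1..<Suc ?q} = d" "{1..<Suc ?q} - insert (Suc ?q) d = {1..?q} - d"
        using d by auto
      \<comment> \<open>All letters of the right word precede the last position; their number is the
        exponent of the twist in \<open>shr\<close>.\<close>
      have "card ({1..?q} - d) = Suc (length v)" using d by (simp add: card_Diff_subset fin)
      then show ?thesis using d unfolding shuffle_entry_def * by (simp add: nth_append)
    qed
    ultimately show ?thesis unfolding upt by (simp del: upt_Suc rev.simps map_eq_conv)
  qed
  let ?f = "\<lambda>d. prod_list (map (?S ?xu ?yv d) [1..<Suc (Suc ?q)])"
  have notin: "d \<in> ?D m \<Longrightarrow> Suc ?q \<notin> d" for d m by auto
  have "(\<Sum>d\<in>{d. d \<subseteq> {1..Suc ?q} \<and> card d = Suc (length u)}. ?f d) =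
      sum ?f (?D (Suc (length u))) + sum ?f (insert (Suc ?q) ` ?D (length u))"
    unfolding subsets_Suc[of ?q] by (rule sum.union_disjoint) (use notin in auto)
  also have "sum ?f (insert (Suc ?q) ` ?D (length u)) = (\<Sum>d\<in>?D (length u). ?f (insert (Suc ?q) d))"
  proof -
    have "inj_on (insert (Suc ?q)) (?D (length u))"
      by (rule inj_onI) (metis insert_ident notin)
    then show ?thesis by (simp only: sum.reindex o_def)
  qed
  also have "\<dots> = (\<Sum>d\<in>?D (length u). prod_list (map (?S (rev u) ?yv d) [1..<Suc ?q]) * tw x (Suc (length v)))"
    by (rule sum.cong[OF refl left])
  also have "\<dots> = shr u (y # v) * tw x (Suc (length v))"
    using 3(1) by (simp add: sum_distrib_right del: upt_Suc rev.simps)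
  also have "sum ?f (?D (Suc (length u))) =
      (\<Sum>d\<in>?D (Suc (length u)). prod_list (map (?S ?xu (rev v) d) [1..<Suc ?q]) * gen y)"
    by (rule sum.cong[OF refl right])
  also have "\<dots> = shr (x # u) v * gen y"
    using 3(2) by (simp add: sum_distrib_right del: upt_Suc rev.simps)
  finally show ?case by (simp add: add.commute del: upt_Suc rev.simps)
qed


section \<open>The Nichols algebra inside the path algebra\<close>

text \<open>The source is a parameter because the tail of a concatenation no longer starts at the
  unit.\<close>

definition emb :: "'g \<Rightarrow> (idx word \<Rightarrow>\<^sub>0 'k::field) \<Rightarrow> ('g path \<Rightarrow>\<^sub>0 'k)"
  where "emb h = lext (\<lambda>w. Poly_Mapping.single (Path h (letters w)) 1)"

lemma lin_emb [lin_intros]: "lin f \<Longrightarrow> lin (\<lambda>x. emb h (f x))"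
  unfolding emb_def by (rule lin_comp[OF lin_lext])

lemmas emb_lin_simps [simp] = lin_add[OF lin_emb[OF lin_ident]] lin_scal[OF lin_emb[OF lin_ident]]
  lin_zero[OF lin_emb[OF lin_ident]]

lemma emb_mon: "emb h (mon u) = Poly_Mapping.single (Path h u) 1"
  by (simp add: emb_def mon_def)

lemma lookup_emb: "Poly_Mapping.lookup (emb h x) (Path h u) = Poly_Mapping.lookup x (Word u)"
proof -
  have "Poly_Mapping.lookup (emb h x) (Path h u) =
      (\<Sum>s\<in>Poly_Mapping.keys x. if s = Word u then Poly_Mapping.lookup x s else 0)"
    unfolding emb_def lext_def lookup_sum
    by (rule sum.cong) (auto simp: lookup_single when_def intro: word.expand)
  then show ?thesis by (simp add: in_keys_iff)
qed

lemma emb_eq_0_iff: "emb h x = 0 \<longleftrightarrow> x = 0"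
proof
  assume 0: "emb h x = 0"
  show "x = 0"
  proof (rule poly_mapping_eqI)
    fix s
    show "Poly_Mapping.lookup x s = Poly_Mapping.lookup 0 s"
      using lookup_emb[of h x "letters s"] by (simp add: 0)
  qed
qed simp

definition letter :: "(idx \<Rightarrow>\<^sub>0 'k::field) \<Rightarrow> (idx word \<Rightarrow>\<^sub>0 'k)"
  where "letter v = scal (Poly_Mapping.lookup v V1) (gen V1) + scal (Poly_Mapping.lookup v V2) (gen V2)"

lemma tens_conv_emb: "tens h v = emb h (letter v)"
  by (simp add: tens_def letter_def gen_mon emb_mon)

lemma letter_bas [simp]: "letter (bas i) = gen i"
  by (cases i) (simp_all add: letter_def lookup_single)

section \<open>Products of paths that start at the unit\<close>

locale jordan_plane =
  fixes G :: "('g, 'm) monoid_scheme" (structure)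
    and g :: 'g and act :: "(idx \<Rightarrow>\<^sub>0 'k::field) \<Rightarrow> 'g \<Rightarrow> (idx \<Rightarrow>\<^sub>0 'k)"
  assumes group: "group G" and g [simp]: "g \<in> carrier G"
    and module: "right_group_module G act"
    and act_V1: "act (bas V1) g = bas V1" and act_V2: "act (bas V2) g = bas V1 + bas V2"
begin

interpretation group G by (rule group)

lemma act_pow:
  "act (bas V1) (g [^] (k :: nat)) = bas V1"
  "act (bas V2) (g [^] (k :: nat)) = bas V2 + scal (of_nat k) (bas V1)"
proof -
  have lin: "lin (\<lambda>v. act v g)" and one: "act v \<one> = v"
    and mult: "act v (g [^] (k :: nat) \<otimes> g) = act (act v (g [^] k)) g" for v k
    using module by (auto simp: right_group_module_def)
  show "act (bas V1) (g [^] (k :: nat)) = bas V1"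
    by (induction k) (simp_all add: one mult act_V1)
  show "act (bas V2) (g [^] (k :: nat)) = bas V2 + scal (of_nat k) (bas V1)"
    by (induction k)
      (simp_all add: one mult act_V1 act_V2 lin_add[OF lin] lin_scal[OF lin] vec.scale_left_distrib add_ac
        single_add del: scal_single)
qed

lemma letter_act: "letter (act (bas i) (g [^] (k :: nat))) = tw i k"
  by (cases i) (simp_all add: act_pow, simp add: letter_def lookup_add lookup_single add.commute)

lemma concat_tens_emb:
  fixes v :: "idx \<Rightarrow>\<^sub>0 'k"
  assumes "h \<in> carrier G"
  shows "bilin (path_concat G g) (tens h v) (emb (h \<otimes> g) x) = emb h (letter v * x)"
proof (rule lin_eq_monI[of "\<lambda>x. bilin (path_concat G g) (tens h v) (emb (h \<otimes> g) x)"])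
  fix u
  let ?P = "bilin (path_concat G g)"
  have "path_concat G g (Path h [i]) (Path (h \<otimes> g) u) =
      (emb h (gen i * mon u) :: 'g path \<Rightarrow>\<^sub>0 'k)" for i
    using assms by (simp add: path_concat_def tgt_def len_def emb_mon flip: mon_Cons)
  then show "?P (tens h v) (emb (h \<otimes> g) (mon u)) = emb h (letter v * mon u)"
    by (simp add: emb_mon tens_def letter_def distrib_right
        lin_add[OF lin_bilin_left[OF lin_ident]])
qed (intro lin_intros)+

lemma concat_seq_Cons:
  "xs \<noteq> [] \<Longrightarrow> concat_seq G g (x # xs) = bilin (path_concat G g) x (concat_seq G g xs)"
  by (cases xs) simp_all

text \<open>The offset \<open>m\<close> makes the induction work: removing the first arrow moves the
  source from one power of \<open>g\<close> to the next.\<close>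

lemma concat_seq_tens:
  fixes v :: "nat \<Rightarrow> (idx \<Rightarrow>\<^sub>0 'k)"
  shows "concat_seq G g (map (\<lambda>i. tens (g [^] (i - 1)) (v i)) [Suc m..<Suc (Suc m + n)]) =
    emb (g [^] m) (prod_list (map (\<lambda>i. letter (v i)) [Suc m..<Suc (Suc m + n)]))"
proof (induction n arbitrary: m)
  case 0
  then show ?case by (simp add: tens_conv_emb)
next
  case (Suc n)
  have upt: "[Suc m..<Suc (Suc m + Suc n)] = Suc m # [Suc (Suc m)..<Suc (Suc (Suc m) + n)]"
    by (subst upt_conv_Cons) simp_all
  have "g [^] Suc m = g [^] m \<otimes> g" by simp
  then show ?case
    unfolding upt list.map
    by (subst concat_seq_Cons) (simp_all only: Suc.IH, simp_all add: concat_tens_emb del: upt_Suc)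
qed

text \<open>Before position \<open>i\<close> the two paths have together used \<open>i - 1\<close>
  arrows, so the \<open>i\<close>-th product starts at that power of \<open>g\<close> and
  consecutive ones are composable. The arrows of the right path used so far give the power of
  \<open>g\<close> acting on a letter of the left one.\<close>

lemma entry_mult_thin:
  assumes i: "i \<in> {1..q}"
  shows "entry_mult G act (thin G g d (Path \<one> u) i) (thin G g ({1..q} - d) (Path \<one> v) i) =
    tens (g [^] (i - 1)) (if i \<in> d then act (bas (u ! card (d \<inter> {1..<i}))) (g [^] card ({1..<i} - d))
      else bas (v ! card ({1..<i} - d)))"
proof -
  have *: "({1..q} - d) \<inter> {1..<i} = {1..<i} - d" using i by auto
  have "card (d \<inter> {1..<i}) + card ({1..<i} - d) = card {1..<i}"
    using card_Int_Diff[of "{1..<i}" d] by (simp add: Int_commute)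
  then have "g [^] card (d \<inter> {1..<i}) \<otimes> g [^] card ({1..<i} - d) = g [^] (i - 1)"
    by (simp add: nat_pow_mult)
  then show ?thesis
    using i by (simp add: thin_def Let_def * del: One_nat_def)
qed

lemma path_mult_one:
  "path_mult G g act (Path \<one> u) (Path \<one> v) = emb \<one> (shr (rev u) (rev v))"
proof (cases "length u + length v")
  case 0
  then show ?thesis
    by (simp add: path_mult_def len_def emb_mon)
next
  case (Suc q)
  have "concat_seq G g (map (\<lambda>i. entry_mult G act (thin G g d (Path \<one> u) i)
          (thin G g ({1..Suc q} - d) (Path \<one> v) i)) [1..<Suc (Suc q)]) =
      emb \<one> (prod_list (map (shuffle_entry u v d) [1..<Suc (Suc q)]))" for d
  proof -
    let ?v = "\<lambda>i. if i \<in> d then act (bas (u ! card (d \<inter> {1..<i}))) (g [^] card ({1..<i} - d))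
      else bas (v ! card ({1..<i} - d))"
    have "map (\<lambda>i. entry_mult G act (thin G g d (Path \<one> u) i)
          (thin G g ({1..Suc q} - d) (Path \<one> v) i)) [1..<Suc (Suc q)] =
        map (\<lambda>i. tens (g [^] (i - 1)) (?v i)) [1..<Suc (Suc q)]"
      by (rule map_cong[OF refl], rule entry_mult_thin) auto
    also have "concat_seq G g \<dots> = emb \<one> (prod_list (map (\<lambda>i. letter (?v i)) [1..<Suc (Suc q)]))"
      using concat_seq_tens[of ?v 0 q] by (simp del: upt_Suc)
    also have "(\<lambda>i. letter (?v i)) = shuffle_entry u v d"
      by (auto simp: fun_eq_iff shuffle_entry_def letter_act)
    finally show ?thesis .
  qed
  then show ?thesis
    by (simp add: path_mult_def len_def Let_def Suc shr_conv_sum_subsets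
        lin_sum[OF lin_emb[OF lin_ident]] del: upt_Suc)
qed

lemma path_mult_emb: "bilin (path_mult G g act) (emb \<one> x) (emb \<one> y) = emb \<one> (x \<star> y)"
proof (rule lin_eq_mon_revI[of "\<lambda>x. bilin (path_mult G g act) (emb \<one> x) (emb \<one> y)"])
  fix u
  show "bilin (path_mult G g act) (emb \<one> (mon (rev u))) (emb \<one> y) = emb \<one> (mon (rev u) \<star> y)"
  proof (rule lin_eq_mon_revI[of "\<lambda>y. bilin (path_mult G g act) (emb \<one> (mon (rev u))) (emb \<one> y)"])
    show "bilin (path_mult G g act) (emb \<one> (mon (rev u))) (emb \<one> (mon (rev v))) =
        emb \<one> (mon (rev u) \<star> mon (rev v))" for v
      by (simp add: qmul_mon) (simp add: emb_mon path_mult_one)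
  qed (intro lin_intros)+
qed (intro lin_intros)+

section \<open>The algebra map from the tensor algebra onto the Nichols algebra\<close>

definition proj :: "(idx word \<Rightarrow>\<^sub>0 'k) \<Rightarrow> ('g path \<Rightarrow>\<^sub>0 'k)"
  where "proj x = emb \<one> (qsym x)"

lemma lin_proj: "lin proj"
  unfolding proj_def by (intro lin_intros)

lemma nichols_algebra_simps:
  "carrier (nichols_algebra G g act) = nichols_carrier G g act"
  "x \<otimes>\<^bsub>nichols_algebra G g act\<^esub> y = bilin (path_mult G g act) x y"
  "x \<oplus>\<^bsub>nichols_algebra G g act\<^esub> y = x + y"
  "\<one>\<^bsub>nichols_algebra G g act\<^esub> = Poly_Mapping.single (Path \<one> []) 1"
  "\<zero>\<^bsub>nichols_algebra G g act\<^esub> = 0"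
  by (simp_all add: nichols_algebra_def path_algebra_def)

lemma proj_mult: "proj (x * y) = bilin (path_mult G g act) (proj x) (proj y)"
  by (simp add: proj_def qsym_mult path_mult_emb)

lemma proj_one: "proj 1 = Poly_Mapping.single (Path \<one> []) 1"
  using emb_mon[of \<one> "[]"] by (simp add: proj_def mon_Nil)

lemma proj_gen: "proj (gen i) = tens \<one> (bas i)"
  by (simp add: proj_def tens_conv_emb)

text \<open>The range of \<open>proj\<close> has all closure properties of the generated subalgebra;
  conversely the image of a word is a product of generators.\<close>

lemma nichols_carrier_eq: "nichols_carrier G g act = range proj"
proof
  show "nichols_carrier G g act \<subseteq> range proj"
  proof
    fix x assume "x \<in> nichols_carrier G g act"
    then show "x \<in> range proj"
    proof induction
      case one
      have "\<one>\<^bsub>path_algebra G g act\<^esub> = proj 1"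
        by (simp add: path_algebra_def proj_one)
      then show ?case by simp
    next
      case (gens v)
      have "tens \<one> v = proj (letter v)"
        by (simp add: tens_conv_emb proj_def letter_def)
      then show ?case by simp
    next
      case (add x y)
      then obtain x' y' where "x = proj x'" "y = proj y'" by blast
      then have "x + y = proj (x' + y')" by (simp add: lin_add[OF lin_proj])
      then show ?case by (simp add: path_algebra_def)
    next
      case (scal x c)
      then obtain x' where "x = proj x'" by blast
      then have "scal c x = proj (scal c x')" by (simp add: lin_scal[OF lin_proj])
      then show ?case by simp
    next
      case (mult x y)
      then obtain x' y' where "x = proj x'" "y = proj y'" by blast
      then have "bilin (path_mult G g act) x y = proj (x' * y')" by (simp add: proj_mult)
      then show ?case by (simp add: path_algebra_def)
    qed
  qed
  let ?C = "nichols_carrier G g act"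
  have add: "x \<in> ?C \<Longrightarrow> y \<in> ?C \<Longrightarrow> x + y \<in> ?C" for x y
    using nichols_carrier.add[of x G g act y] by (simp add: path_algebra_def)
  have one: "proj 1 \<in> ?C"
    using nichols_carrier.one[of G g act] by (simp add: path_algebra_def proj_one)
  \<comment> \<open>The closure rules have no clause for zero, which is recovered as a scalar
    multiple of the unit.\<close>
  then have zero: "0 \<in> ?C"
    using nichols_carrier.scal[of "proj 1" G g act 0] by simp
  have mon: "proj (mon u) \<in> ?C" for u
  proof (induction u)
    case Nil
    then show ?case by (simp add: mon_Nil one)
  next
    case (Cons i u)
    have "proj (mon (i # u)) = tens \<one> (bas i) \<otimes>\<^bsub>path_algebra G g act\<^esub> proj (mon u)"
      by (simp add: mon_Cons proj_mult proj_gen path_algebra_def)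
    then show ?case using nichols_carrier.mult[OF nichols_carrier.gens Cons] by simp
  qed
  have sum: "finite A \<Longrightarrow> (\<And>s. s \<in> A \<Longrightarrow> f s \<in> ?C) \<Longrightarrow> sum f A \<in> ?C" for f and A :: "idx word set"
    by (induction A rule: finite_induct) (auto intro: add zero)
  show "range proj \<subseteq> ?C"
  proof
    fix y assume "y \<in> range proj"
    then obtain x where x: "y = proj x" by blast
    have "proj x = (\<Sum>s\<in>Poly_Mapping.keys x.
        scal (Poly_Mapping.lookup x s) (proj (Poly_Mapping.single s 1)))"
      using arg_cong[OF sum_scal_keys[of x], of proj]
      by (simp only: lin_sum[OF lin_proj] lin_scal[OF lin_proj])
    also have "\<dots> \<in> ?C"
    proof (intro sum nichols_carrier.scal)
      show "proj (Poly_Mapping.single s 1) \<in> ?C" for s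
        using mon[of "letters s"] by (simp add: mon_def)
    qed simp
    finally show "y \<in> ?C" by (simp add: x)
  qed
qed

lemma proj_ring_hom: "proj \<in> ring_hom ring_of_type_algebra (nichols_algebra G g act)"
  by (rule ring_hom_memI)
    (simp_all add: nichols_algebra_simps nichols_carrier_eq proj_mult proj_one lin_add[OF lin_proj])

text \<open>The axioms are inherited from the tensor algebra along the surjection
  \<open>proj\<close>; associativity of the shuffle product has entered through
  \<open>qsym_mult\<close>.\<close>

lemma ring_nichols_algebra: "ring (nichols_algebra G g act)"
proof -
  \<comment> \<open>The image ring carries updated carrier and zero fields; both updates change
    nothing here.\<close>
  have "(nichols_algebra G g act)\<lparr>carrier := proj ` carrier ring_of_type_algebra,
      zero := proj \<zero>\<^bsub>ring_of_type_algebra\<^esub>\<rparr> = nichols_algebra G g act"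
    by (simp add: nichols_algebra_def path_algebra_def nichols_carrier_eq lin_zero[OF lin_proj])
  then show ?thesis
    using ring.ring_hom_imp_img_ring[OF ring_tensor_ring proj_ring_hom] by simp
qed

lemma ring_hom_ring_proj: "ring_hom_ring ring_of_type_algebra (nichols_algebra G g act) proj"
  by (rule ring_hom_ringI2[OF ring_tensor_ring ring_nichols_algebra proj_ring_hom])

lemma proj_eq_0_iff: "proj x = 0 \<longleftrightarrow> qsym x = 0"
  by (simp add: proj_def emb_eq_0_iff)

section \<open>Kernel, basis and dimension in characteristic p\<close>

context
  fixes p :: nat and a b :: "idx word \<Rightarrow>\<^sub>0 'k" and I and f and A
  assumes char: "CHAR('k) = p" and p: "p > 2"
  defines "a \<equiv> gen V1" and "b \<equiv> gen V2"
    and "I \<equiv> Idl\<^bsub>tensor_ring\<^esub> {a ^ p, b ^ p, b * a - a * b - scal (1 / 2) (a ^ 2)}"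
    and "f \<equiv> \<lambda>(i, j). a ^ i * b ^ j" and "A \<equiv> {..<p} \<times> {..<p}"
begin

lemma of_nat_fact_nonzero: "m < p \<Longrightarrow> of_nat (fact m) \<noteq> (0 :: 'k)"
proof (induction m)
  case (Suc m)
  have "of_nat (Suc m) \<noteq> (0 :: 'k)"
    unfolding of_nat_eq_0_iff_char_dvd char using Suc.prems by (auto dest: dvd_imp_le)
  then show ?case using Suc by (simp del: of_nat_Suc mult_Suc)
qed simp

lemma proj_monomials_independent:
  assumes "(\<Sum>ij\<in>A. scal (c ij) (proj (f ij))) = 0"
  shows "\<forall>ij\<in>A. c ij = 0"
proof -
  have "proj (\<Sum>ij\<in>A. scal (c ij) (f ij)) = 0"
    using assms by (simp only: lin_sum[OF lin_proj] lin_scal[OF lin_proj])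
  then have "qsym (\<Sum>ij\<in>A. scal (c ij) (f ij)) = 0"
    by (simp only: proj_eq_0_iff)
  then have "(\<Sum>(i, j)\<in>{..<p} \<times> {..<p}. scal (c (i, j)) (qsym (gen V1 ^ i * gen V2 ^ j))) = 0"
    by (simp add: lin_sum[OF lin_qsym[OF lin_ident]] f_def a_def b_def A_def case_prod_beta')
  then show ?thesis
    using qsym_monomials_independent[OF of_nat_fact_nonzero] unfolding A_def by blast
qed

lemma ideal_I: "ideal I tensor_ring"
  unfolding I_def by (rule ring.genideal_ideal[OF ring_tensor_ring]) simp

lemma relations_in_I: "{a ^ p, b ^ p, b * a - a * b - scal (1 / 2) (a ^ 2)} \<subseteq> I"
  unfolding I_def by (rule ring.genideal_self[OF ring_tensor_ring]) simp

lemma span_monomials_I: "vec.span (f ` A \<union> I) = UNIV"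
  using span_monomials_ideal[OF ideal_I, of p] relations_in_I p
  unfolding f_def A_def a_def b_def by simp

lemma I_subset_kernel: "I \<subseteq> a_kernel tensor_ring (nichols_algebra G g act) proj"
  unfolding I_def
  using qsym_relations[OF char p]
  by (intro ring.genideal_minimal[OF ring_tensor_ring] ring_hom_ring.kernel_is_ideal[OF ring_hom_ring_proj])
    (simp add: a_kernel_def' nichols_algebra_simps proj_eq_0_iff a_def b_def)

lemma proj_I: "x \<in> I \<Longrightarrow> proj x = 0"
  using I_subset_kernel by (auto simp: a_kernel_def' nichols_algebra_simps)

lemma finite_A: "finite A"
  by (simp add: A_def)

lemma inj_on_proj_f: "inj_on (\<lambda>ij. proj (f ij)) A"
  and independent_proj_f: "vec.independent ((\<lambda>ij. proj (f ij)) ` A)"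
  by (rule independent_family[OF finite_A], rule proj_monomials_independent, assumption)+

text \<open>Modulo \<open>I\<close> a kernel element is a combination of the monomials; their images
  are independent, so all its coefficients vanish and only the part in \<open>I\<close>
  remains.\<close>

lemma kernel_eq_I: "a_kernel tensor_ring (nichols_algebra G g act) proj = I"
proof
  show "a_kernel tensor_ring (nichols_algebra G g act) proj \<subseteq> I"
  proof
    fix x assume "x \<in> a_kernel tensor_ring (nichols_algebra G g act) proj"
    then have x: "proj x = 0" by (simp add: a_kernel_def' nichols_algebra_simps)
    have inj: "inj_on f A" using inj_on_proj_f by (auto simp: inj_on_def)
    have "x \<in> vec.span (f ` A \<union> I)" by (simp add: span_monomials_I)
    then obtain y z where yz: "x = y + z" "y \<in> vec.span (f ` A)" "z \<in> vec.span I"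
      unfolding vec.span_Un by blast
    have "z \<in> I"
      using yz(3) vec.span_minimal[OF subset_refl subspace_ideal[OF ideal_I]] by blast
    obtain c where "y = (\<Sum>v\<in>f ` A. scal (c v) v)"
      using yz(2) vec.span_finite[of "f ` A"] finite_A by auto
    then have y: "y = (\<Sum>ij\<in>A. scal (c (f ij)) (f ij))"
      by (simp add: sum.reindex[OF inj])
    have "proj y = 0"
      using x proj_I[OF \<open>z \<in> I\<close>] by (simp add: yz(1) lin_add[OF lin_proj])
    then have "(\<Sum>ij\<in>A. scal (c (f ij)) (proj (f ij))) = 0"
      by (simp add: y lin_sum[OF lin_proj] lin_scal[OF lin_proj])
    then have "\<forall>ij\<in>A. c (f ij) = 0" by (rule proj_monomials_independent)
    then have "y = 0" by (simp add: y)
    then show "x \<in> I" using \<open>z \<in> I\<close> yz(1) by simp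
  qed
qed (rule I_subset_kernel)

text \<open>The monomials together with \<open>I\<close> span the tensor algebra, and
  \<open>proj\<close> kills \<open>I\<close>.\<close>

lemma span_proj_f: "vec.span ((\<lambda>ij. proj (f ij)) ` A) = nichols_carrier G g act"
proof -
  let ?S = "(\<lambda>ij. proj (f ij)) ` A"
  have "vec.subspace (range proj)"
  proof (rule vec.subspaceI)
    show "0 \<in> range proj" using lin_zero[OF lin_proj] by (metis rangeI)
    show "x \<in> range proj \<Longrightarrow> y \<in> range proj \<Longrightarrow> x + y \<in> range proj" for x y
      by (auto simp flip: lin_add[OF lin_proj])
    show "x \<in> range proj \<Longrightarrow> scal c x \<in> range proj" for c x
      by (auto simp flip: lin_scal[OF lin_proj])
  qed
  then have "vec.span ?S \<subseteq> range proj" by (intro vec.span_minimal) auto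
  moreover have "proj x \<in> vec.span ?S" for x
  proof -
    have "vec.subspace {x. proj x \<in> vec.span ?S}"
      by (rule vec.subspaceI)
        (auto simp: lin_zero[OF lin_proj] lin_add[OF lin_proj] lin_scal[OF lin_proj]
          intro: vec.span_zero vec.span_add vec.span_scale)
    moreover have "f ` A \<union> I \<subseteq> {x. proj x \<in> vec.span ?S}"
      by (auto simp: proj_I intro: vec.span_zero vec.span_base)
    ultimately have "vec.span (f ` A \<union> I) \<subseteq> {x. proj x \<in> vec.span ?S}"
      by (rule vec.span_minimal[rotated])
    then show ?thesis by (auto simp: span_monomials_I)
  qed
  ultimately show ?thesis by (auto simp: nichols_carrier_eq)
qed

lemma dim_nichols_carrier: "vec.dim (nichols_carrier G g act) = p ^ 2"
proof -
  have "vec.dim (nichols_carrier G g act) = card ((\<lambda>ij. proj (f ij)) ` A)"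
    using vec.dim_span_eq_card_independent[OF independent_proj_f] by (simp add: span_proj_f)
  also have "\<dots> = p ^ 2"
    unfolding card_image[OF inj_on_proj_f] by (simp add: A_def power2_eq_square)
  finally show ?thesis .
qed

text \<open>The first isomorphism theorem; \<open>proj\<close> is constant on each coset of its
  kernel \<open>I\<close>, and the isomorphism picks that single value.\<close>

lemma quotient_iso:
  "\<exists>\<phi> \<in> ring_iso (tensor_ring Quot I) (nichols_algebra G g act).
    \<forall>x. \<phi> (I +>\<^bsub>tensor_ring\<^esub> x) = proj x"
proof (intro bexI allI)
  interpret ring_hom_ring "tensor_ring :: (idx word \<Rightarrow>\<^sub>0 'k) ring" "nichols_algebra G g act" proj
    by (rule ring_hom_ring_proj)
  show "the_elem (proj ` (I +>\<^bsub>tensor_ring\<^esub> x)) = proj x" for x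
    using the_elem_simp[of x] by (simp add: kernel_eq_I)
  have "(nichols_algebra G g act)\<lparr>carrier := range proj\<rparr> = nichols_algebra G g act"
    by (simp add: nichols_algebra_def nichols_carrier_eq)
  then show "(\<lambda>Y. the_elem (proj ` Y)) \<in> ring_iso (tensor_ring Quot I) (nichols_algebra G g act)"
    using FactRing_iso_set_aux by (simp add: kernel_eq_I)
qed

lemma proj_monomials_image: "{proj (a ^ i * b ^ j) | i j. i \<le> p - 1 \<and> j \<le> p - 1} = (\<lambda>ij. proj (f ij)) ` A"
proof -
  \<comment> \<open>Subtraction on naturals is truncated, so this rests on \<open>p\<close> being
    positive.\<close>
  have *: "i \<le> p - 1 \<longleftrightarrow> i < p" for i using p by auto
  show ?thesis
  proof (intro equalityI subsetI)
    fix x assume "x \<in> {proj (a ^ i * b ^ j) | i j. i \<le> p - 1 \<and> j \<le> p - 1}"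
    then obtain i j where "x = proj (f (i, j))" "(i, j) \<in> A"
      unfolding * by (auto simp: f_def A_def)
    then show "x \<in> (\<lambda>ij. proj (f ij)) ` A" by blast
  next
    fix x assume "x \<in> (\<lambda>ij. proj (f ij)) ` A"
    then obtain i j where "i < p" "j < p" "x = proj (a ^ i * b ^ j)"
      by (auto simp: f_def A_def)
    then show "x \<in> {proj (a ^ i * b ^ j) | i j. i \<le> p - 1 \<and> j \<le> p - 1}"
      unfolding * by blast
  qed
qed

end

end

theorem theorem3p5:
  fixes G :: "('g, 'm) monoid_scheme"
    and g :: 'g
    and act :: "(idx \<Rightarrow>\<^sub>0 'k::field) \<Rightarrow> 'g \<Rightarrow> (idx \<Rightarrow>\<^sub>0 'k)"
    and n p :: nat
    and a b :: "idx word \<Rightarrow>\<^sub>0 'k"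
    and B :: "('g path \<Rightarrow>\<^sub>0 'k) ring"
    and I :: "(idx word \<Rightarrow>\<^sub>0 'k) set"
  assumes "CHAR('k) = p" and "p > 2"
    and "group G" and "g \<in> carrier G" and "carrier G = generate G {g}"
    and "Coset.order G = n" and "n > 0" and "p dvd n"
    and "right_group_module G act"
    and "act (bas V1) g = bas V1" and "act (bas V2) g = bas V1 + bas V2"
  defines "a \<equiv> gen V1" and "b \<equiv> gen V2"
    and "B \<equiv> nichols_algebra G g act"
    and "I \<equiv> Idl\<^bsub>tensor_ring\<^esub> {a ^ p, b ^ p, b * a - a * b - scal (1 / 2) (a ^ 2)}"
  shows "\<exists>\<pi> \<in> ring_hom tensor_ring B.
           Vector_Spaces.linear scal scal \<pi> \<and>
           \<pi> a = tens \<one>\<^bsub>G\<^esub> (bas V1) \<and> \<pi> b = tens \<one>\<^bsub>G\<^esub> (bas V2) \<and>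
           (\<exists>\<phi> \<in> ring_iso (tensor_ring Quot I) B. \<forall>x. \<phi> (I +>\<^bsub>tensor_ring\<^esub> x) = \<pi> x) \<and>
           vec.dim (carrier B) = p ^ 2 \<and>
           (let S = {\<pi> (a ^ i * b ^ j) | i j. i \<le> p - 1 \<and> j \<le> p - 1}
            in vec.independent S \<and> vec.span S = carrier B)"
proof -
  interpret jordan_plane G g act
    by (rule jordan_plane.intro; fact)
  note char = assms(1,2)
  show ?thesis
    unfolding B_def nichols_algebra_simps Let_def I_def a_def b_def
      proj_monomials_image[OF char]
  proof (intro bexI[of _ proj] conjI)
    show "\<exists>\<phi> \<in> ring_iso (tensor_ring Quot Idl\<^bsub>tensor_ring\<^esub> {gen V1 ^ p, gen V2 ^ p,
          gen V2 * gen V1 - gen V1 * gen V2 - scal (1 / 2) (gen V1 ^ 2)}) (nichols_algebra G g act).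
        \<forall>x. \<phi> (Idl\<^bsub>tensor_ring\<^esub> {gen V1 ^ p, gen V2 ^ p,
          gen V2 * gen V1 - gen V1 * gen V2 - scal (1 / 2) (gen V1 ^ 2)} +>\<^bsub>tensor_ring\<^esub> x) = proj x"
      by (rule quotient_iso[OF char])
  qed (use proj_monomials_image[OF char] in \<open>simp_all add: proj_gen lin_proj proj_ring_hom dim_nichols_carrier[OF char]
      independent_proj_f[OF char] span_proj_f[OF char]\<close>)
qed

end
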